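(* Let $\mathcal V$ be a variety of finite signature such that $\mathcal V_{f.g.}$ has the ascending chain condition. Then (1) if the word problem for finite presentations in $\mathcal V$ is decidable, $\cong_{\mathcal V_{f.g.}}$ is $\Delta^0_2$; and (2) if the isomorphism problem for finite presentations in $\mathcal V$ is decidable, $\cong_{\mathcal V_{f.g.}}$ is $\Delta^0_2$.
   Context: $W_e$ denotes the $e$-th c.e. set and $\langle\cdot,\cdot\rangle$ a computable pairing function. A variety is the class of algebras in a fixed algebraic signature satisfying a fixed c.e. set of equational laws. For $k\ge1$, $X_k=\{x_0,\dots,x_{k-1}\}$; fix a computable bijective coding of pairs of terms over $X_k$ by natural numbers, and let $\langle X_k\mid R\rangle_{\mathcal V}$ be $\mathcal T(X_k)$ modulo the smallest congruence containing $R$ and all instances of the laws of $\mathcal V$. $\mathcal V_{f.g.}$ consists of $\mathcal V_{f.g.}[\langle k,e\rangle]=\langle X_k\mid W_e\rangle_{\mathcal V}$ ($k\ge1$), and $\langle k,e\rangle\cong_{\mathcal V_{f.g.}}\langle j,i\rangle$ iff these are isomorphic (a subset of $\mathbb N^2$). ACC: every ascending chain of congruences of every algebra in $\mathcal V_{f.g.}$ is eventually constant. The word problem for finite presentations is decidable if there is an algorithm deciding, given $k$, a finite set $R$ and terms $s,t$ over $X_k$, whether $s=t$ in $\langle X_k\mid R\rangle_{\mathcal V}$; the isomorphism problem for finite presentations is decidable if there is an algorithm deciding, for $k,j$ and finite $R,S$, whether $\langle X_k\mid R\rangle_{\mathcal V}\cong\langle X_j\mid S\rangle_{\mathcal V}$.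 *)

theory Defs
  imports Main "HOL-Library.Nat_Bijection"
begin

section \<open>Computability\<close>

text \<open>
  Kleene's partial recursive functions, presented as unary functions on the naturals; several
  arguments are passed through the pairing function \<^const>\<open>prod_encode\<close>.
  The identity function is \<open>CPair CFst CSnd\<close>.
\<close>

datatype prog =
    CZero
  | CSucc
  | CFst
  | CSnd
  | CPair prog prog
  | CComp prog prog
  | CRec prog prog
  | CMu prog

inductive eval :: "prog \<Rightarrow> nat \<Rightarrow> nat \<Rightarrow> bool" where
  zero: "eval CZero x 0"
| succ: "eval CSucc x (Suc x)"
| fst: "eval CFst (prod_encode (a, b)) a"
| snd: "eval CSnd (prod_encode (a, b)) b"
| pair: "eval p x a \<Longrightarrow> eval q x b \<Longrightarrow> eval (CPair p q) x (prod_encode (a, b))"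
| comp: "eval q x y \<Longrightarrow> eval p y z \<Longrightarrow> eval (CComp p q) x z"
| rec_0: "eval p a y \<Longrightarrow> eval (CRec p q) (prod_encode (a, 0)) y"
| rec_Suc: "eval (CRec p q) (prod_encode (a, n)) y \<Longrightarrow>
    eval q (prod_encode (a, prod_encode (n, y))) z \<Longrightarrow>
    eval (CRec p q) (prod_encode (a, Suc n)) z"
| mu: "eval p (prod_encode (a, n)) 0 \<Longrightarrow>
    \<forall>m<n. \<exists>y. eval p (prod_encode (a, m)) (Suc y) \<Longrightarrow>
    eval (CMu p) a n"

primrec prog_code :: "prog \<Rightarrow> nat" where
  "prog_code CZero = 0"
| "prog_code CSucc = 1"
| "prog_code CFst = 2"
| "prog_code CSnd = 3"
| "prog_code (CPair p q) = 4 * prod_encode (prog_code p, prog_code q) + 4"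
| "prog_code (CComp p q) = 4 * prod_encode (prog_code p, prog_code q) + 5"
| "prog_code (CRec p q) = 4 * prod_encode (prog_code p, prog_code q) + 6"
| "prog_code (CMu p) = 4 * prog_code p + 7"

definition W :: "nat \<Rightarrow> nat set" where
  "W e = {x. \<exists>p y. prog_code p = e \<and> eval p x y}"

definition ce :: "nat set \<Rightarrow> bool" where
  "ce A \<longleftrightarrow> (\<exists>e. A = W e)"

definition computable :: "(nat \<Rightarrow> nat) \<Rightarrow> bool" where
  "computable f \<longleftrightarrow> (\<exists>p. \<forall>x. eval p x (f x))"

definition decidable :: "nat set \<Rightarrow> bool" where
  "decidable A \<longleftrightarrow> computable (\<lambda>x. if x \<in> A then 1 else 0)"

text \<open>The second level of the arithmetical hierarchy, for binary relations on the naturals.\<close>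

definition Sigma02 :: "(nat \<times> nat) set \<Rightarrow> bool" where
  "Sigma02 A \<longleftrightarrow> (\<exists>R. decidable R \<and>
     A = {(x, y). \<exists>u. \<forall>v. prod_encode (prod_encode (x, y), prod_encode (u, v)) \<in> R})"

definition Pi02 :: "(nat \<times> nat) set \<Rightarrow> bool" where
  "Pi02 A \<longleftrightarrow> (\<exists>R. decidable R \<and>
     A = {(x, y). \<forall>u. \<exists>v. prod_encode (prod_encode (x, y), prod_encode (u, v)) \<in> R})"

definition Delta02 :: "(nat \<times> nat) set \<Rightarrow> bool" where
  "Delta02 A \<longleftrightarrow> Sigma02 A \<and> Pi02 A"

text \<open>Every natural number is the code of exactly one program, so \<open>W e\<close> is the domain of one
  program for every \<open>e\<close>.\<close>

lemma prog_code_inj: "prog_code p = prog_code q \<Longrightarrow> p = q"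
proof (induction p arbitrary: q)
  case CZero
  then show ?case by (cases q) auto
next
  case CSucc
  then show ?case by (cases q) auto
next
  case CFst
  then show ?case by (cases q) auto
next
  case CSnd
  then show ?case by (cases q) auto
next
  case (CPair p1 p2)
  have "4 * a + 4 \<noteq> 4 * b + 5" "4 * a + 4 \<noteq> 4 * b + 6" "4 * a + 4 \<noteq> 4 * b + 7"
    for a b :: nat by presburger+
  with CPair show ?case by (cases q) (simp_all only: prog_code.simps, auto)
next
  case (CComp p1 p2)
  have "4 * a + 5 \<noteq> 4 * b + 4" "4 * a + 5 \<noteq> 4 * b + 6" "4 * a + 5 \<noteq> 4 * b + 7"
    for a b :: nat by presburger+
  with CComp show ?case by (cases q) (simp_all only: prog_code.simps, auto)
next
  case (CRec p1 p2)
  have "4 * a + 6 \<noteq> 4 * b + 4" "4 * a + 6 \<noteq> 4 * b + 5" "4 * a + 6 \<noteq> 4 * b + 7"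
    for a b :: nat by presburger+
  with CRec show ?case by (cases q) (simp_all only: prog_code.simps, auto)
next
  case (CMu p)
  have "4 * a + 7 \<noteq> 4 * b + 4" "4 * a + 7 \<noteq> 4 * b + 5" "4 * a + 7 \<noteq> 4 * b + 6"
    for a b :: nat by presburger+
  with CMu show ?case by (cases q) (simp_all only: prog_code.simps, auto)
qed

lemma prog_code_surj: "\<exists>p. prog_code p = e"
proof (induction e rule: less_induct)
  case (less e)
  show ?case
  proof (cases "e < 4")
    case True
    then have "e = 0 \<or> e = 1 \<or> e = 2 \<or> e = 3" by auto
    then show ?thesis
      using prog_code.simps(1-4) by metis
  next
    case False
    define n where "n = (e - 4) div 4"
    obtain a b where ab: "prod_decode n = (a, b)" by (cases "prod_decode n")
    then have n: "n = prod_encode (a, b)" by (metis prod_decode_inverse)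
    have "n < e" using False by (auto simp: n_def)
    moreover have "a \<le> n" "b \<le> n" by (auto simp: n le_prod_encode_1 le_prod_encode_2)
    ultimately have "a < e" "b < e" by simp_all
    then obtain p q r
      where pqr: "prog_code p = a" "prog_code q = b" "prog_code r = n"
      using less[of a] less[of b] less[OF \<open>n < e\<close>] by blast
    have "(e - 4) div 4 * 4 + (e - 4) mod 4 = e - 4" "(e - 4) mod 4 < 4" by simp_all
    then have "e = 4 * n + 4 \<or> e = 4 * n + 5 \<or> e = 4 * n + 6 \<or> e = 4 * n + 7"
      using False unfolding n_def by arith
    then have "e = prog_code (CPair p q) \<or> e = prog_code (CComp p q) \<or>
        e = prog_code (CRec p q) \<or> e = prog_code (CMu r)"
      by (simp add: pqr n)
    then show ?thesis by blast
  qed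
qed

lemma bij_prog_code: "bij prog_code"
  using prog_code_inj prog_code_surj unfolding bij_def inj_def surj_def by metis

section \<open>Algebras\<close>

text \<open>A finite signature is the list of the arities of its operation symbols \<open>0, 1, 2, \<dots>\<close>.\<close>

type_synonym signature = "nat list"

record 'a algebra =
  carrier :: "'a set"
  oper :: "nat \<Rightarrow> 'a list \<Rightarrow> 'a"

definition congruence :: "signature \<Rightarrow> 'a algebra \<Rightarrow> ('a \<times> 'a) set \<Rightarrow> bool" where
  "congruence sig A \<theta> \<longleftrightarrow> equiv (carrier A) \<theta> \<and>
     (\<forall>f as bs. f < length sig \<and> length as = sig ! f \<and> list_all2 (\<lambda>a b. (a, b) \<in> \<theta>) as bs
        \<longrightarrow> (oper A f as, oper A f bs) \<in> \<theta>)"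

text \<open>The operations of a quotient apply the original one to all tuples of representatives.\<close>

definition quotient_algebra :: "'a algebra \<Rightarrow> ('a \<times> 'a) set \<Rightarrow> 'a set algebra" where
  "quotient_algebra A \<theta> =
     \<lparr>carrier = carrier A // \<theta>, oper = (\<lambda>f Cs. \<Union>as\<in>listset Cs. \<theta> `` {oper A f as})\<rparr>"

definition isomorphic :: "signature \<Rightarrow> 'a algebra \<Rightarrow> 'b algebra \<Rightarrow> bool" where
  "isomorphic sig A B \<longleftrightarrow> (\<exists>h. bij_betw h (carrier A) (carrier B) \<and>
     (\<forall>f as. f < length sig \<and> length as = sig ! f \<and> set as \<subseteq> carrier A
        \<longrightarrow> h (oper A f as) = oper B f (map h as)))"

definition acc_congruences :: "signature \<Rightarrow> 'a algebra \<Rightarrow> bool" where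
  "acc_congruences sig A \<longleftrightarrow>
     (\<forall>C :: nat \<Rightarrow> ('a \<times> 'a) set. (\<forall>n. congruence sig A (C n)) \<and> (\<forall>n. C n \<subseteq> C (Suc n))
        \<longrightarrow> (\<exists>N. \<forall>n\<ge>N. C n = C N))"

section \<open>Terms and their coding\<close>

datatype trm = Var nat | Op nat "trm list"

inductive_set trms :: "signature \<Rightarrow> nat set \<Rightarrow> trm set" for sig X where
  "i \<in> X \<Longrightarrow> Var i \<in> trms sig X"
| "f < length sig \<Longrightarrow> length ts = sig ! f \<Longrightarrow> \<forall>t\<in>set ts. t \<in> trms sig X \<Longrightarrow> Op f ts \<in> trms sig X"

definition term_algebra :: "signature \<Rightarrow> nat \<Rightarrow> trm algebra" where
  "term_algebra sig k = \<lparr>carrier = trms sig {..<k}, oper = Op\<rparr>"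

primrec subst :: "(nat \<Rightarrow> trm) \<Rightarrow> trm \<Rightarrow> trm" where
  "subst \<sigma> (Var i) = \<sigma> i"
| "subst \<sigma> (Op f ts) = Op f (map (subst \<sigma>) ts)"

primrec trm_code :: "trm \<Rightarrow> nat" where
  "trm_code (Var i) = sum_encode (Inl i)"
| "trm_code (Op f ts) = sum_encode (Inr (prod_encode (f, list_encode (map trm_code ts))))"

definition goedel :: "trm \<times> trm \<Rightarrow> nat" where
  "goedel = (\<lambda>(s, t). prod_encode (trm_code s, trm_code t))"

definition trm_pairs :: "signature \<Rightarrow> nat \<Rightarrow> (trm \<times> trm) set" where
  "trm_pairs sig k = trms sig {..<k} \<times> trms sig {..<k}"

text \<open>
  For \<open>k \<ge> 1\<close>, the coding of the pairs of terms over the first \<open>k\<close> variables lists these pairs in the order of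
  their Goedel numbers. It is a bijection onto the natural numbers, except when the signature has
  constants only: there are then finitely many pairs, and their codes form an initial segment.
\<close>

definition pair_code :: "signature \<Rightarrow> nat \<Rightarrow> trm \<times> trm \<Rightarrow> nat" where
  "pair_code sig k p = card {q \<in> trm_pairs sig k. goedel q < goedel p}"

definition decode_rels :: "signature \<Rightarrow> nat \<Rightarrow> nat set \<Rightarrow> (trm \<times> trm) set" where
  "decode_rels sig k A = {p \<in> trm_pairs sig k. pair_code sig k p \<in> A}"

lemma trm_code_inj: "trm_code s = trm_code t \<Longrightarrow> s = t"
proof (induction s arbitrary: t)
  case (Var i)
  then show ?case by (cases t) (auto dest: injD[OF inj_sum_encode])
next
  case (Op f ss)
  show ?case
  proof (cases t)
    case (Var i)
    then show ?thesis using Op.prems by (auto dest: injD[OF inj_sum_encode])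
  next
    case (Op g ts)
    with Op.prems have fg: "f = g" and m: "map trm_code ss = map trm_code ts"
      by (auto dest!: injD[OF inj_sum_encode] injD[OF inj_list_encode])
    have len: "length ss = length ts" using m by (metis length_map)
    have "ss = ts"
    proof (rule nth_equalityI[OF len])
      fix i assume i: "i < length ss"
      then have "trm_code (ss ! i) = trm_code (ts ! i)" using m len by (metis nth_map)
      then show "ss ! i = ts ! i" using Op.IH i nth_mem by blast
    qed
    then show ?thesis using Op fg by simp
  qed
qed

lemma inj_goedel: "inj goedel"
  by (auto simp: inj_def goedel_def trm_code_inj)

lemma bij_betw_card_less:
  fixes g :: "'a \<Rightarrow> nat"
  assumes "inj_on g S" "infinite S"
  shows "bij_betw (\<lambda>p. card {q \<in> S. g q < g p}) S UNIV"
proof -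
  have inf: "infinite (g ` S)" using assms by (simp add: finite_image_iff)
  have card_eq: "card {q \<in> S. g q < g p} = card {m \<in> g ` S. m < g p}" for p
  proof -
    have "{m \<in> g ` S. m < g p} = g ` {q \<in> S. g q < g p}" by auto
    then show ?thesis using assms(1) by (simp add: card_image inj_on_def)
  qed
  have strict: "card {m \<in> T. m < a} < card {m \<in> T. m < b}" if "a \<in> T" "a < b"
    for a b :: nat and T
    by (rule psubset_card_mono) (use that in auto)
  have surj: "\<exists>a\<in>T. card {m \<in> T. m < a} = n" if "infinite T" for n and T :: "nat set"
  proof (induction n)
    case 0
    define a where "a = (LEAST m. m \<in> T)"
    have "\<exists>m. m \<in> T" using that by (metis finite.emptyI ex_in_conv)
    then have "a \<in> T" unfolding a_def by (rule LeastI_ex)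
    moreover have "{m \<in> T. m < a} = {}" unfolding a_def using not_less_Least by auto
    ultimately show ?case by (metis card.empty)
  next
    case (Suc n)
    then obtain a where a: "a \<in> T" "card {m \<in> T. m < a} = n" by auto
    define b where "b = (LEAST m. m \<in> T \<and> a < m)"
    have "\<exists>m. m \<in> T \<and> a < m" using that
      unfolding finite_nat_set_iff_bounded_le by (auto simp: not_le)
    then have "b \<in> T \<and> a < b" unfolding b_def by (rule LeastI_ex)
    then have b: "b \<in> T" "a < b" by simp_all
    have least: "m \<le> a" if "m \<in> T" "m < b" for m
      using not_less_Least[of m "\<lambda>m. m \<in> T \<and> a < m"] that unfolding b_def by auto
    have "{m \<in> T. m < b} = insert a {m \<in> T. m < a}"
      using a(1) b by (auto dest: least)
    then have "card {m \<in> T. m < b} = Suc n" using a by simp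
    then show ?case using b by auto
  qed
  show ?thesis
    unfolding card_eq bij_betw_def
  proof
    show "inj_on (\<lambda>p. card {m \<in> g ` S. m < g p}) S"
    proof (rule inj_onI)
      fix p q assume "p \<in> S" "q \<in> S"
        and eq: "card {m \<in> g ` S. m < g p} = card {m \<in> g ` S. m < g q}"
      then have "g p = g q"
        using strict[of "g p" "g ` S" "g q"] strict[of "g q" "g ` S" "g p"]
        by (cases "g p" "g q" rule: linorder_cases) auto
      then show "p = q" using assms(1) \<open>p \<in> S\<close> \<open>q \<in> S\<close> by (auto dest: inj_onD)
    qed
    show "(\<lambda>p. card {m \<in> g ` S. m < g p}) ` S = UNIV"
    proof -
      have "\<exists>p\<in>S. n = card {m \<in> g ` S. m < g p}" for n
        using surj[OF inf, of n] by auto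
      then show ?thesis by auto
    qed
  qed
qed

lemma bij_betw_pair_code:
  assumes "infinite (trm_pairs sig k)"
  shows "bij_betw (pair_code sig k) (trm_pairs sig k) UNIV"
  using bij_betw_card_less[OF inj_on_subset[OF inj_goedel subset_UNIV] assms]
  unfolding pair_code_def[abs_def] .

section \<open>Varieties and presentations\<close>

text \<open>
  A variety is given by its signature and its defining laws, whose terms may use all variables
  \<open>Var 0, Var 1, \<dots>\<close>.
\<close>

record variety =
  vsig :: signature
  laws :: "(trm \<times> trm) set"

definition is_variety :: "variety \<Rightarrow> bool" where
  "is_variety V \<longleftrightarrow>
     laws V \<subseteq> trms (vsig V) UNIV \<times> trms (vsig V) UNIV \<and> ce (goedel ` laws V)"

definition law_instances :: "variety \<Rightarrow> nat \<Rightarrow> (trm \<times> trm) set" where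
  "law_instances V k = {(subst \<sigma> l, subst \<sigma> r) | \<sigma> l r.
     (l, r) \<in> laws V \<and> (\<forall>i. \<sigma> i \<in> trms (vsig V) {..<k})}"

definition pres_cong :: "variety \<Rightarrow> nat \<Rightarrow> (trm \<times> trm) set \<Rightarrow> (trm \<times> trm) set" where
  "pres_cong V k R =
     \<Inter>{\<theta>. congruence (vsig V) (term_algebra (vsig V) k) \<theta> \<and> R \<union> law_instances V k \<subseteq> \<theta>}"

definition presented :: "variety \<Rightarrow> nat \<Rightarrow> (trm \<times> trm) set \<Rightarrow> trm set algebra" where
  "presented V k R = quotient_algebra (term_algebra (vsig V) k) (pres_cong V k R)"

definition Vfg :: "variety \<Rightarrow> nat \<Rightarrow> nat \<Rightarrow> trm set algebra" where
  "Vfg V k e = presented V k (decode_rels (vsig V) k (W e))"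

definition iso_Vfg :: "variety \<Rightarrow> (nat \<times> nat) set" where
  "iso_Vfg V = {(prod_encode (k, e), prod_encode (j, i)) | k e j i.
     1 \<le> k \<and> 1 \<le> j \<and> isomorphic (vsig V) (Vfg V k e) (Vfg V j i)}"

definition Vfg_acc :: "variety \<Rightarrow> bool" where
  "Vfg_acc V \<longleftrightarrow> (\<forall>k\<ge>1. \<forall>e. acc_congruences (vsig V) (Vfg V k e))"

text \<open>
  In the two decision problems a finite set of relations is given by its canonical index:
  \<^term>\<open>set_decode r\<close> is the set of positions of the binary digits 1 of \<open>r\<close>.
\<close>

definition fin_presented :: "variety \<Rightarrow> nat \<Rightarrow> nat \<Rightarrow> trm set algebra" where
  "fin_presented V k r = presented V k (decode_rels (vsig V) k (set_decode r))"

definition word_problem_decidable :: "variety \<Rightarrow> bool" where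
  "word_problem_decidable V \<longleftrightarrow> decidable
     {prod_encode (k, prod_encode (r, pair_code (vsig V) k (s, t))) | k r s t.
        1 \<le> k \<and> (s, t) \<in> trm_pairs (vsig V) k \<and>
        (let \<theta> = pres_cong V k (decode_rels (vsig V) k (set_decode r)) in \<theta> `` {s} = \<theta> `` {t})}"

definition isomorphism_problem_decidable :: "variety \<Rightarrow> bool" where
  "isomorphism_problem_decidable V \<longleftrightarrow> decidable
     {prod_encode (prod_encode (k, r), prod_encode (j, s)) | k r j s.
        1 \<le> k \<and> 1 \<le> j \<and> isomorphic (vsig V) (fin_presented V k r) (fin_presented V j s)}"

end

theory Submission
  imports Defs
begin

text \<open>
  By the ascending chain condition, \<open>W e\<close> has a finite subset \<open>r\<close> generating the same congruence, so
  the algebra presented by \<open>W e\<close> is presented by \<open>r\<close>. With a decidable word problem, being such an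
  \<open>r\<close> is the conjunction of the c.e. condition \<open>r \<subseteq> W e\<close> and the co-c.e. condition that every relation
  in \<open>W e\<close> holds in the algebra presented by \<open>r\<close>. Isomorphism of two finite presentations is c.e.: it
  is witnessed by a pair of mutually inverse substitutions. Hence isomorphism is expressed both by
  ``some good \<open>r\<close>, \<open>s\<close> present isomorphic algebras'' (\<open>\<Sigma>\<close>) and by ``all good \<open>r\<close>, \<open>s\<close> present
  isomorphic algebras'' (\<open>\<Pi>\<close>).

  A decidable isomorphism problem makes the word problem decidable: the algebras are Hopfian by the
  ascending chain condition, so \<open>s = t\<close> holds in the algebra presented by \<open>r\<close> if and only if adding
  the relation \<open>s = t\<close> to \<open>r\<close> yields an isomorphic algebra.
\<close>

section \<open>Computable functions\<close>

text \<open>The existential and the universal form agree because every good \<open>r\<close>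
  generates exactly the congruence of \<open>W e\<close>: a good \<open>r\<close> always exists, and
  the answer does not depend on which one is taken. Finiteness of \<open>r\<close> matters a second
  time. A substitution is a homomorphism as soon as it respects the relations of \<open>r\<close>,
  and two substitutions are mutually inverse as soon as both composites fix the generators. A
  candidate isomorphism is thus verified by finitely many equality queries. Each decision problem is
  used only to obtain a decidable relation on codes that answers such queries, so the main argument
  is carried out once, over an abstract relation of this kind. The obstacle on the computability
  side is that c.e. sets are given as domains of programs. They have to be brought into the form
  "some number passes a decidable test", and terms and substitutions have to be handled as
  numbers.\<close>

definition pfst :: "nat \<Rightarrow> nat" where "pfst n = fst (prod_decode n)"
definition psnd :: "nat \<Rightarrow> nat" where "psnd n = snd (prod_decode n)"

lemma pfst_prod_encode [simp]: "pfst (prod_encode (a, b)) = a"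
  and psnd_prod_encode [simp]: "psnd (prod_encode (a, b)) = b"
  by (simp_all add: pfst_def psnd_def)

lemma prod_encode_pfst_psnd [simp]: "prod_encode (pfst n, psnd n) = n"
  by (simp add: pfst_def psnd_def)

lemma prod_encode_eq_iff: "prod_encode (a, b) = n \<longleftrightarrow> a = pfst n \<and> b = psnd n"
  by (metis pfst_prod_encode psnd_prod_encode prod_encode_pfst_psnd)

lemma pfst_0 [simp]: "pfst 0 = 0" and psnd_0 [simp]: "psnd 0 = 0"
  using prod_encode_eq_iff[of 0 0 0] by (simp_all add: prod_encode_def)

named_theorems comp_intros

lemma computable_id [comp_intros]: "computable (\<lambda>z. z)"
proof -
  have "eval (CPair CFst CSnd) z z" for z
    using eval.pair[OF eval.fst eval.snd, of "pfst z" "psnd z"] by simp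
  then show ?thesis unfolding computable_def by blast
qed

lemma computable_comp:
  assumes "computable f" "computable g"
  shows "computable (\<lambda>z. f (g z))"
  using assms unfolding computable_def by (metis eval.comp)

lemma computable_pfst [comp_intros]: "computable f \<Longrightarrow> computable (\<lambda>z. pfst (f z))"
proof (rule computable_comp[of pfst])
  have "eval CFst z (pfst z)" for z
    using eval.fst[of "pfst z" "psnd z"] by simp
  then show "computable pfst" unfolding computable_def by blast
qed

lemma computable_psnd [comp_intros]: "computable f \<Longrightarrow> computable (\<lambda>z. psnd (f z))"
proof (rule computable_comp[of psnd])
  have "eval CSnd z (psnd z)" for z
    using eval.snd[of "pfst z" "psnd z"] by simp
  then show "computable psnd" unfolding computable_def by blast
qed

lemma computable_Suc [comp_intros]: "computable f \<Longrightarrow> computable (\<lambda>z. Suc (f z))"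
  by (rule computable_comp[of Suc]) (use eval.succ in \<open>auto simp: computable_def\<close>)

lemma computable_prod_encode [comp_intros]:
  "computable f \<Longrightarrow> computable g \<Longrightarrow> computable (\<lambda>z. prod_encode (f z, g z))"
  unfolding computable_def by (metis eval.pair)

lemma computable_const [comp_intros]: "computable (\<lambda>z. n)"
proof (induction n)
  case 0
  show ?case using eval.zero unfolding computable_def by blast
qed (rule computable_Suc)

lemma computable2:
  assumes "computable (\<lambda>w. F (pfst w) (psnd w))" "computable f" "computable g"
  shows "computable (\<lambda>z. F (f z) (g z))"
  using computable_comp[OF assms(1) computable_prod_encode[OF assms(2,3)]] by simp

text \<open>\<open>CRec\<close> carries one parameter unchanged through the recursion. The whole
  input \<open>z\<close> is passed as that parameter, which lets both the start value and the step
  depend on it.\<close>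

lemma computable_rec_nat [comp_intros]:
  assumes "computable f" "computable (\<lambda>w. g (pfst w) (pfst (psnd w)) (psnd (psnd w)))"
    "computable h"
  shows "computable (\<lambda>z. rec_nat (f z) (\<lambda>n y. g z n y) (h z))"
proof (rule computable2[of "\<lambda>z n. rec_nat (f z) (\<lambda>n y. g z n y) n", OF _ computable_id assms(3)])
  obtain p q where p: "\<And>x. eval p x (f x)"
    and q: "\<And>w. eval q w (g (pfst w) (pfst (psnd w)) (psnd (psnd w)))"
    using assms(1,2) unfolding computable_def by blast
  have "eval (CRec p q) (prod_encode (a, n)) (rec_nat (f a) (\<lambda>n y. g a n y) n)" for a n
  proof (induction n)
    case 0
    show ?case using eval.rec_0[OF p] by simp
  next
    case (Suc n)
    show ?case
      using eval.rec_Suc[OF Suc q[of "prod_encode (a, prod_encode (n, _))"]] by simp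
  qed
  then have "eval (CRec p q) w (rec_nat (f (pfst w)) (\<lambda>n y. g (pfst w) n y) (psnd w))" for w
    by (metis prod_encode_pfst_psnd)
  then show "computable (\<lambda>w. rec_nat (f (pfst w)) (\<lambda>n y. g (pfst w) n y) (psnd w))"
    unfolding computable_def by blast
qed

section \<open>Decidable predicates and their closure under logical connectives\<close>

definition dec :: "(nat \<Rightarrow> bool) \<Rightarrow> bool" where
  "dec P \<longleftrightarrow> computable (\<lambda>z. if P z then 1 else 0)"

lemma decidable_iff_dec: "decidable A \<longleftrightarrow> dec (\<lambda>z. z \<in> A)"
  by (simp add: decidable_def dec_def)

lemma dec_comp: "dec P \<Longrightarrow> computable f \<Longrightarrow> dec (\<lambda>z. P (f z))"
  unfolding dec_def by (rule computable_comp[of "\<lambda>z. if P z then 1 else 0"])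

lemma dec2:
  assumes "dec (\<lambda>w. F (pfst w) (psnd w))" "computable f" "computable g"
  shows "dec (\<lambda>z. F (f z) (g z))"
  using dec_comp[OF assms(1) computable_prod_encode[OF assms(2,3)]] by simp

lemma dec3:
  assumes "dec (\<lambda>w. F (pfst w) (pfst (psnd w)) (psnd (psnd w)))"
    "computable f" "computable g" "computable h"
  shows "dec (\<lambda>z. F (f z) (g z) (h z))"
  using dec_comp[OF assms(1) computable_prod_encode[OF assms(2)
    computable_prod_encode[OF assms(3,4)]]] by simp

text \<open>The characteristic value serves as the depth of a recursion, which returns the start
  value \<open>g z\<close> at depth 0 and \<open>f z\<close> at depth 1.\<close>

lemma computable_if [comp_intros]:
  assumes "dec P" "computable f" "computable g"
  shows "computable (\<lambda>z. if P z then f z else g z)"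
proof -
  have "computable (\<lambda>z. rec_nat (g z) (\<lambda>n y. f z) (if P z then 1 else 0))"
    by (intro comp_intros computable_comp[OF assms(2)] assms(1)[unfolded dec_def] assms)
  moreover have "rec_nat (g z) (\<lambda>n y. f z) (if P z then 1 else 0) = (if P z then f z else g z)" for z
    by simp
  ultimately show ?thesis by simp
qed

lemma dec_not [comp_intros]:
  assumes "dec P"
  shows "dec (\<lambda>z. \<not> P z)"
proof -
  have "computable (\<lambda>z. if P z then 0 else 1)"
    by (intro comp_intros assms)
  moreover have "(if P z then 0 else 1) = (if \<not> P z then 1 else (0::nat))" for z
    by simp
  ultimately show ?thesis by (simp only: dec_def)
qed

lemma dec_conj [comp_intros]:
  assumes "dec P" "dec Q"
  shows "dec (\<lambda>z. P z \<and> Q z)"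
proof -
  have "computable (\<lambda>z. if P z then if Q z then 1 else 0 else 0)"
    by (intro comp_intros assms)
  moreover have "(if P z then if Q z then 1 else 0 else 0) = (if P z \<and> Q z then 1 else (0::nat))" for z
    by simp
  ultimately show ?thesis by (simp add: dec_def)
qed

lemma dec_disj [comp_intros]:
  assumes "dec P" "dec Q"
  shows "dec (\<lambda>z. P z \<or> Q z)"
  using dec_not[OF dec_conj[OF dec_not[OF assms(1)] dec_not[OF assms(2)]]] by simp

lemma dec_imp [comp_intros]:
  assumes "dec P" "dec Q"
  shows "dec (\<lambda>z. P z \<longrightarrow> Q z)"
  using dec_disj[OF dec_not[OF assms(1)] assms(2)] by (simp only: imp_conv_disj)

lemma dec_eq_0: 
  assumes "computable f"
  shows "dec (\<lambda>z. f z = 0)"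
proof -
  have "computable (\<lambda>z. rec_nat 1 (\<lambda>n y. 0) (f z))"
    by (intro comp_intros assms)
  moreover have "rec_nat 1 (\<lambda>n y. 0) m = (if m = 0 then 1 else (0::nat))" for m
    by (cases m) auto
  ultimately show ?thesis by (simp only: dec_def)
qed

section \<open>Arithmetic, bounded quantifiers and search\<close>

lemma computable_add [comp_intros]:
  assumes "computable f" "computable g"
  shows "computable (\<lambda>z. f z + g z)"
proof -
  have "computable (\<lambda>z. rec_nat (f z) (\<lambda>n y. Suc y) (g z))"
    by (intro comp_intros assms)
  moreover have "rec_nat m (\<lambda>n y. Suc y) n = m + n" for m n
    by (induction n) auto
  ultimately show ?thesis by (simp only:)
qed

lemma computable_diff [comp_intros]:
  assumes "computable f" "computable g"
  shows "computable (\<lambda>z. f z - g z)"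
proof -
  have pred: "rec_nat 0 (\<lambda>n y. n) m = m - 1" for m :: nat
    by (cases m) auto
  have "computable (\<lambda>z. rec_nat (f z) (\<lambda>n y. rec_nat 0 (\<lambda>n y. n) y) (g z))"
    by (intro comp_intros assms)
  moreover have "rec_nat m (\<lambda>n y. rec_nat 0 (\<lambda>n y. n) y) n = m - n" for m n :: nat
    by (induction n) (auto simp: pred)
  ultimately show ?thesis by (simp only:)
qed

lemma computable_mult [comp_intros]:
  assumes "computable f" "computable g"
  shows "computable (\<lambda>z. f z * g z)"
proof -
  have "computable (\<lambda>z. rec_nat 0 (\<lambda>n y. y + f z) (g z))"
    by (intro comp_intros computable_comp[OF assms(1)] assms)
  moreover have "rec_nat 0 (\<lambda>n y. y + m) n = m * n" for m n :: nat
    by (induction n) auto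
  ultimately show ?thesis by (simp only:)
qed

lemma computable_power [comp_intros]:
  assumes "computable f" "computable g"
  shows "computable (\<lambda>z. f z ^ g z)"
proof -
  have "computable (\<lambda>z. rec_nat 1 (\<lambda>n y. y * f z) (g z))"
    by (intro comp_intros computable_comp[OF assms(1)] assms)
  moreover have "rec_nat 1 (\<lambda>n y. y * m) n = m ^ n" for m n :: nat
    by (induction n) auto
  ultimately show ?thesis by (simp only:)
qed

lemma dec_le [comp_intros]:
  assumes "computable f" "computable g"
  shows "dec (\<lambda>z. f z \<le> g z)"
  using dec_eq_0[OF computable_diff[OF assms]] by simp

lemma dec_less [comp_intros]:
  assumes "computable f" "computable g"
  shows "dec (\<lambda>z. f z < g z)"
  using dec_le[OF computable_Suc[OF assms(1)] assms(2)] by (simp only: Suc_le_eq)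

lemma dec_eq [comp_intros]:
  assumes "computable f" "computable g"
  shows "dec (\<lambda>z. f z = g z)"
  using dec_conj[OF dec_le[OF assms] dec_le[OF assms(2,1)]] by (simp only: order_eq_iff[where 'a = nat])

lemma dec_ball [comp_intros]:
  assumes "dec (\<lambda>w. P (pfst w) (psnd w))" "computable f"
  shows "dec (\<lambda>z. \<forall>i<f z. P z i)"
proof -
  have "computable (\<lambda>z. rec_nat 1 (\<lambda>n y. if P z n then y else 0) (f z))"
    by (intro comp_intros dec2[OF assms(1)] assms)
  moreover have "rec_nat 1 (\<lambda>n y. if P z n then y else 0) m = (if \<forall>i<m. P z i then 1 else (0::nat))" for z m
    by (induction m) (auto simp: less_Suc_eq)
  ultimately show ?thesis by (simp only: dec_def)
qed

lemma dec_bex [comp_intros]: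
  assumes "dec (\<lambda>w. P (pfst w) (psnd w))" "computable f"
  shows "dec (\<lambda>z. \<exists>i<f z. P z i)"
  using dec_not[OF dec_ball[OF dec_not[OF assms(1)] assms(2)]] by simp

lemma computable_card [comp_intros]:
  assumes "dec (\<lambda>w. P (pfst w) (psnd w))" "computable f"
  shows "computable (\<lambda>z. card {i. i < f z \<and> P z i})"
proof -
  have "computable (\<lambda>z. rec_nat 0 (\<lambda>n y. if P z n then Suc y else y) (f z))"
    by (intro comp_intros dec2[OF assms(1)] assms)
  moreover have "rec_nat 0 (\<lambda>n y. if P z n then Suc y else y) m = card {i. i < m \<and> P z i}" for z m
  proof (induction m)
    case (Suc m)
    have "{i. i < Suc m \<and> P z i} = (if P z m then insert m {i. i < m \<and> P z i} else {i. i < m \<and> P z i})"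
      by (auto simp: less_Suc_eq)
    then show ?case using Suc by simp
  qed auto
  ultimately show ?thesis by (simp only:)
qed

lemma computable_Least:
  assumes "dec (\<lambda>w. P (pfst w) (psnd w))" "\<And>z. \<exists>n. P z n"
  shows "computable (\<lambda>z. LEAST n. P z n)"
proof -
  \<comment> \<open>\<open>CMu\<close> searches for a zero, so truth is represented by 0 here,
    against the convention of \<open>dec\<close>.\<close>
  have "computable (\<lambda>w. if P (pfst w) (psnd w) then 0 else 1)"
    by (intro comp_intros assms)
  then obtain p where p: "\<And>w. eval p w (if P (pfst w) (psnd w) then 0 else 1)"
    unfolding computable_def by blast
  have "eval (CMu p) z (LEAST n. P z n)" for z
  proof (rule eval.mu)
    show "eval p (prod_encode (z, LEAST n. P z n)) 0"
      using p[of "prod_encode (z, LEAST n. P z n)"] LeastI_ex[OF assms(2), of z] by simp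
    show "\<forall>m<LEAST n. P z n. \<exists>y. eval p (prod_encode (z, m)) (Suc y)"
    proof (intro allI impI)
      fix m assume "m < (LEAST n. P z n)"
      then have "\<not> P z m" by (rule not_less_Least)
      then show "\<exists>y. eval p (prod_encode (z, m)) (Suc y)"
        using p[of "prod_encode (z, m)"] by auto
    qed
  qed
  then show ?thesis unfolding computable_def by blast
qed

text \<open>The value is found by searching the decidable graph; division is obtained in this
  way.\<close>

lemma computable_graph:
  assumes "dec (\<lambda>w. P (pfst w) (psnd w))" "\<And>z n. P z n \<longleftrightarrow> n = f z"
  shows "computable f"
proof -
  have "computable (\<lambda>z. LEAST n. P z n)"
    by (rule computable_Least) (use assms in auto)
  then show ?thesis by (simp add: assms(2) Least_equality)
qed

lemma computable_div [comp_intros]: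
  assumes "computable f" "computable g"
  shows "computable (\<lambda>z. f z div g z)"
proof (rule computable_graph)
  let ?P = "\<lambda>z n. (g z = 0 \<and> n = 0) \<or> (n * g z \<le> f z \<and> f z < Suc n * g z)"
  show "dec (\<lambda>w. ?P (pfst w) (psnd w))"
    by (intro comp_intros computable_comp[OF assms(1)] computable_comp[OF assms(2)])
  show "?P z n \<longleftrightarrow> n = f z div g z" for z n
    by (cases "g z = 0") (auto simp: div_nat_eqI dividend_less_times_div mult.commute intro: div_times_less_eq_dividend)
qed

text \<open>Parity is expressed as an equation between arithmetic terms, so that the closure rules
  for decidability apply to canonical indices.\<close>

lemma in_set_decode_iff: "i \<in> set_decode n \<longleftrightarrow> n div 2 ^ i = 2 * (n div 2 ^ i div 2) + 1"
proof -
  have "odd m \<longleftrightarrow> m = 2 * (m div 2) + 1" for m :: nat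
    by presburger
  then show ?thesis by (simp only: set_decode_def mem_Collect_eq)
qed

lemma dec_in_set_decode [comp_intros]:
  assumes "computable f" "computable g"
  shows "dec (\<lambda>z. f z \<in> set_decode (g z))"
  unfolding in_set_decode_iff by (intro comp_intros assms)

lemma in_set_decode_less: "i \<in> set_decode n \<Longrightarrow> i < n"
proof (rule ccontr)
  assume "i \<in> set_decode n" "\<not> i < n"
  then have "n < 2 ^ i"
    by (meson leI le_less_trans less_exp)
  with \<open>i \<in> set_decode n\<close> show False by (simp add: set_decode_def)
qed

text \<open>The answers for all arguments below \<open>n\<close> are the binary digits of a single
  number \<open>T x n\<close>. Course-of-values recursion thereby becomes primitive recursion, with
  the set of earlier positive answers available as a canonical index.\<close>

lemma dec_course_of_values:
  assumes "dec (\<lambda>w. Q (pfst w) (pfst (psnd w)) (set_decode (psnd (psnd w))))"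
  obtains P where "dec (\<lambda>w. P (pfst w) (psnd w))"
    "\<And>x n. P x n \<longleftrightarrow> Q x n {m. m < n \<and> P x m}"
proof -
  define T where "T x n = rec_nat 0 (\<lambda>n t. if Q x n (set_decode t) then 2 ^ n + t else t) n" for x n
  define P where "P x n \<longleftrightarrow> Q x n (set_decode (T x n))" for x n
  have "set_decode (T x n) = {m. m < n \<and> P x m}" for x n
  proof (induction n)
    case 0
    show ?case by (simp add: T_def)
  next
    case (Suc n)
    have "set_decode (T x (Suc n)) = (if P x n then insert n (set_decode (T x n)) else set_decode (T x n))"
      using Suc set_decode_plus_power_2[of n "T x n"] by (simp add: T_def P_def)
    then show ?case unfolding Suc by (auto simp: less_Suc_eq)
  qed
  then have "P x n \<longleftrightarrow> Q x n {m. m < n \<and> P x m}" for x n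
    unfolding P_def by metis
  moreover have "dec (\<lambda>w. P (pfst w) (psnd w))"
    unfolding P_def T_def
    by (rule dec3[of "\<lambda>x n t. Q x n (set_decode t)", OF assms];
        intro comp_intros dec3[of "\<lambda>x n t. Q x n (set_decode t)", OF assms])
  ultimately show ?thesis by (rule that[rotated])
qed

section \<open>Coded lists\<close>

text \<open>A nonempty list is coded by the successor of the pair of its head and its coded tail.
  The step \<open>psnd (y - 1)\<close> maps 0 to 0, so the empty list is its own tail.\<close>

definition drop_code :: "nat \<Rightarrow> nat \<Rightarrow> nat" where
  "drop_code i L = rec_nat L (\<lambda>n y. psnd (y - 1)) i"

definition nth_code :: "nat \<Rightarrow> nat \<Rightarrow> nat" where
  "nth_code L i = pfst (drop_code i L - 1)"

lemma drop_code_list_encode: "drop_code i (list_encode xs) = list_encode (drop i xs)"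
proof (induction i)
  case (Suc i)
  have "psnd (list_encode ys - 1) = list_encode (tl ys)" for ys
    by (cases ys) auto
  then show ?case using Suc by (simp add: drop_code_def drop_Suc tl_drop)
qed (simp add: drop_code_def)

lemma nth_code_list_encode: "i < length xs \<Longrightarrow> nth_code (list_encode xs) i = xs ! i"
  by (simp add: nth_code_def drop_code_list_encode Cons_nth_drop_Suc[symmetric])

text \<open>This makes recursion along codes well founded: a certificate lies above its premises,
  and the code of a term above those of its arguments.\<close>

lemma nth_less_list_encode: "i < length xs \<Longrightarrow> xs ! i < list_encode xs"
proof (induction xs arbitrary: i)
  case (Cons x xs)
  show ?case
  proof (cases i)
    case 0
    then show ?thesis by (simp add: le_imp_less_Suc le_prod_encode_1)
  next
    case (Suc j)
    then have "xs ! j < list_encode xs" using Cons by simp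
    then show ?thesis
      using Suc le_prod_encode_2[of "list_encode xs" x] by simp
  qed
qed simp

lemma length_le_list_encode: "length xs \<le> list_encode xs"
proof (induction xs)
  case (Cons x xs)
  then show ?case using le_prod_encode_2[of "list_encode xs" x] by simp
qed simp

lemma computable_nth_code [comp_intros]:
  assumes "computable f" "computable g"
  shows "computable (\<lambda>z. nth_code (f z) (g z))"
  unfolding nth_code_def drop_code_def by (intro comp_intros assms)

text \<open>The nonempty suffixes are counted. A list is never longer than its code, so the bound
  \<open>L\<close> misses none of them.\<close>

definition length_code :: "nat \<Rightarrow> nat" where
  "length_code L = card {i. i < L \<and> drop_code i L \<noteq> 0}"

lemma length_code_list_encode: "length_code (list_encode xs) = length xs"
proof -
  have *: "list_encode ys = 0 \<longleftrightarrow> ys = []" for ys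
    by (cases ys) auto
  have "{i. i < list_encode xs \<and> drop_code i (list_encode xs) \<noteq> 0} = {..<length xs}"
    using length_le_list_encode[of xs] unfolding drop_code_list_encode * by auto
  then show ?thesis by (simp add: length_code_def)
qed

lemma computable_length_code [comp_intros]:
  assumes "computable f"
  shows "computable (\<lambda>z. length_code (f z))"
proof (rule computable_comp[of length_code, OF _ assms])
  show "computable length_code"
    unfolding length_code_def[abs_def] drop_code_def by (intro comp_intros)
qed

section \<open>Semidecidable predicates\<close>

definition semidec :: "(nat \<Rightarrow> bool) \<Rightarrow> bool" where
  "semidec P \<longleftrightarrow> (\<exists>Q. dec (\<lambda>w. Q (pfst w) (psnd w)) \<and> (\<forall>z. P z \<longleftrightarrow> (\<exists>y. Q z y)))"

named_theorems semidec_intros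

lemma semidecI:
  assumes "dec (\<lambda>w. Q (pfst w) (psnd w))" "\<And>z. P z \<longleftrightarrow> (\<exists>y. Q z y)"
  shows "semidec P"
  using assms unfolding semidec_def by blast

lemma semidecE:
  assumes "semidec P"
  obtains Q where "dec (\<lambda>w. Q (pfst w) (psnd w))" "P = (\<lambda>z. \<exists>y. Q z y)"
  using assms unfolding semidec_def by (metis ext)

lemma semidec_dec:
  assumes "dec P"
  shows "semidec P"
proof (rule semidecI)
  show "dec (\<lambda>w. P (pfst w))"
    by (intro dec_comp[OF assms] comp_intros)
qed simp

lemma semidec_ex [semidec_intros]:
  assumes "semidec (\<lambda>w. P (pfst w) (psnd w))"
  shows "semidec (\<lambda>z. \<exists>x. P z x)"
proof -
  obtain Q where Q: "dec (\<lambda>w. Q (pfst w) (psnd w))"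
    "(\<lambda>w. P (pfst w) (psnd w)) = (\<lambda>w. \<exists>y. Q w y)"
    using assms by (rule semidecE)
  show ?thesis
  proof (rule semidecI)
    show "dec (\<lambda>w. Q (prod_encode (pfst w, pfst (psnd w))) (psnd (psnd w)))"
      by (rule dec2[OF Q(1)]; intro comp_intros)
    show "(\<exists>x. P z x) \<longleftrightarrow> (\<exists>y. Q (prod_encode (z, pfst y)) (psnd y))" for z
    proof -
      have "P z x \<longleftrightarrow> (\<exists>y. Q (prod_encode (z, x)) y)" for x
        using fun_cong[OF Q(2), of "prod_encode (z, x)"] by simp
      then show ?thesis by (metis pfst_prod_encode psnd_prod_encode)
    qed
  qed
qed

lemma semidec_comp:
  assumes "semidec P" "computable f"
  shows "semidec (\<lambda>z. P (f z))"
proof -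
  obtain Q where Q: "dec (\<lambda>w. Q (pfst w) (psnd w))" "P = (\<lambda>z. \<exists>y. Q z y)"
    using assms(1) by (rule semidecE)
  show ?thesis unfolding Q(2)
    by (rule semidecI[of "\<lambda>z. Q (f z)"])
      (auto intro!: dec2[OF Q(1)] computable_comp[OF assms(2)] comp_intros)
qed

lemma semidec_conj [semidec_intros]:
  assumes "semidec P" "semidec Q"
  shows "semidec (\<lambda>z. P z \<and> Q z)"
proof -
  obtain P' where P': "dec (\<lambda>w. P' (pfst w) (psnd w))" "P = (\<lambda>z. \<exists>y. P' z y)"
    using assms(1) by (rule semidecE)
  obtain Q' where Q': "dec (\<lambda>w. Q' (pfst w) (psnd w))" "Q = (\<lambda>z. \<exists>y. Q' z y)"
    using assms(2) by (rule semidecE)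
  show ?thesis
  proof (rule semidecI)
    show "dec (\<lambda>w. P' (pfst w) (pfst (psnd w)) \<and> Q' (pfst w) (psnd (psnd w)))"
      by (intro comp_intros dec2[OF P'(1)] dec2[OF Q'(1)])
    show "P z \<and> Q z \<longleftrightarrow> (\<exists>y. P' z (pfst y) \<and> Q' z (psnd y))" for z
      unfolding P'(2) Q'(2) by (metis pfst_prod_encode psnd_prod_encode)
  qed
qed

text \<open>Witnesses for the finitely many \<open>i\<close> are collected into one coded list,
  which leaves a single unbounded quantifier in front.\<close>

lemma semidec_ball [semidec_intros]:
  assumes "semidec (\<lambda>w. P (pfst w) (psnd w))" "computable f"
  shows "semidec (\<lambda>z. \<forall>i<f z. P z i)"
proof -
  obtain Q where Q: "dec (\<lambda>w. Q (pfst w) (psnd w))"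
    "(\<lambda>w. P (pfst w) (psnd w)) = (\<lambda>w. \<exists>y. Q w y)"
    using assms(1) by (rule semidecE)
  have PQ: "P z i \<longleftrightarrow> (\<exists>y. Q (prod_encode (z, i)) y)" for z i
    using fun_cong[OF Q(2), of "prod_encode (z, i)"] by simp
  show ?thesis
  proof (rule semidecI)
    show "dec (\<lambda>w. \<forall>i<f (pfst w). Q (prod_encode (pfst w, i)) (nth_code (psnd w) i))"
      by (intro comp_intros dec2[OF Q(1)] computable_comp[OF assms(2)])
    show "(\<forall>i<f z. P z i) \<longleftrightarrow> (\<exists>L. \<forall>i<f z. Q (prod_encode (z, i)) (nth_code L i))" for z
    proof
      assume "\<forall>i<f z. P z i"
      then obtain y where y: "\<forall>i<f z. Q (prod_encode (z, i)) (y i)"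
        unfolding PQ by metis
      then have "\<forall>i<f z. Q (prod_encode (z, i)) (nth_code (list_encode (map y [0..<f z])) i)"
        by (simp add: nth_code_list_encode)
      then show "\<exists>L. \<forall>i<f z. Q (prod_encode (z, i)) (nth_code L i)" ..
    qed (auto simp: PQ)
  qed
qed

lemma semidec_disj [semidec_intros]:
  assumes "semidec P" "semidec Q"
  shows "semidec (\<lambda>z. P z \<or> Q z)"
proof -
  obtain P' where P': "dec (\<lambda>w. P' (pfst w) (psnd w))" "P = (\<lambda>z. \<exists>y. P' z y)"
    using assms(1) by (rule semidecE)
  obtain Q' where Q': "dec (\<lambda>w. Q' (pfst w) (psnd w))" "Q = (\<lambda>z. \<exists>y. Q' z y)"
    using assms(2) by (rule semidecE)
  show ?thesis
  proof (rule semidecI)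
    show "dec (\<lambda>w. P' (pfst w) (psnd w) \<or> Q' (pfst w) (psnd w))"
      by (intro comp_intros P'(1) Q'(1))
    show "P z \<or> Q z \<longleftrightarrow> (\<exists>y. P' z y \<or> Q' z y)" for z
      unfolding P'(2) Q'(2) by blast
  qed
qed

lemma semidec_imp [semidec_intros]:
  assumes "dec P" "semidec Q"
  shows "semidec (\<lambda>z. P z \<longrightarrow> Q z)"
  using semidec_disj[OF semidec_dec[OF dec_not[OF assms(1)]] assms(2)] by (simp only: imp_conv_disj)

text \<open>The good choices for \<open>x\<close> are the \<open>u\<close> with \<open>S x u\<close>
  and not \<open>N x u\<close>. Some \<open>u\<close> is good, and on every good \<open>u\<close>
  the predicate \<open>Q\<close> decides membership correctly; so "some good \<open>u\<close>
  satisfies \<open>Q\<close>" and "every good \<open>u\<close> satisfies \<open>Q\<close>" both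
  define \<open>A\<close>.\<close>

lemma Delta02I:
  assumes S: "semidec (\<lambda>w. S (pfst w) (psnd w))" and N: "semidec (\<lambda>w. N (pfst w) (psnd w))"
    and Q: "semidec (\<lambda>w. Q (pfst w) (psnd w))"
    and ex: "\<And>x. \<exists>u. S x u \<and> \<not> N x u"
    and iff: "\<And>a b u. S (prod_encode (a, b)) u \<Longrightarrow> \<not> N (prod_encode (a, b)) u \<Longrightarrow>
      (a, b) \<in> A \<longleftrightarrow> Q (prod_encode (a, b)) u"
  shows "Delta02 A"
proof -
  obtain S' where S': "dec (\<lambda>w. S' (pfst w) (psnd w))"
    "(\<lambda>w. S (pfst w) (psnd w)) = (\<lambda>w. \<exists>y. S' w y)" using S by (rule semidecE)
  obtain N' where N': "dec (\<lambda>w. N' (pfst w) (psnd w))"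
    "(\<lambda>w. N (pfst w) (psnd w)) = (\<lambda>w. \<exists>y. N' w y)" using N by (rule semidecE)
  obtain Q' where Q': "dec (\<lambda>w. Q' (pfst w) (psnd w))"
    "(\<lambda>w. Q (pfst w) (psnd w)) = (\<lambda>w. \<exists>y. Q' w y)" using Q by (rule semidecE)
  have S_iff: "S x u \<longleftrightarrow> (\<exists>y. S' (prod_encode (x, u)) y)" for x u
    using fun_cong[OF S'(2), of "prod_encode (x, u)"] by simp
  have N_iff: "N x u \<longleftrightarrow> (\<exists>y. N' (prod_encode (x, u)) y)" for x u
    using fun_cong[OF N'(2), of "prod_encode (x, u)"] by simp
  have Q_iff: "Q x u \<longleftrightarrow> (\<exists>y. Q' (prod_encode (x, u)) y)" for x u
    using fun_cong[OF Q'(2), of "prod_encode (x, u)"] by simp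
  \<comment> \<open>The existential number \<open>U\<close> packs \<open>u\<close> with witnesses
    for \<open>S\<close> and \<open>Q\<close>; the universal \<open>v\<close> says that nothing
    witnesses \<open>N\<close>.\<close>
  define R1 where "R1 x U v \<longleftrightarrow> S' (prod_encode (x, pfst U)) (pfst (psnd U)) \<and>
    Q' (prod_encode (x, pfst U)) (psnd (psnd U)) \<and> \<not> N' (prod_encode (x, pfst U)) v" for x U v
  \<comment> \<open>Now the witness for \<open>S\<close> is quantified universally together with
    \<open>u\<close>, and one existential \<open>v\<close> witnesses \<open>N\<close> or
    \<open>Q\<close>, whichever holds.\<close>
  define R2 where "R2 x U v \<longleftrightarrow> (S' (prod_encode (x, pfst U)) (psnd U) \<longrightarrow>
    N' (prod_encode (x, pfst U)) v \<or> Q' (prod_encode (x, pfst U)) v)" for x U v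
  have "dec (\<lambda>z. R1 (pfst z) (pfst (psnd z)) (psnd (psnd z)))"
    unfolding R1_def by (intro comp_intros dec2[OF S'(1)] dec2[OF N'(1)] dec2[OF Q'(1)])
  then have R1: "decidable {z. R1 (pfst z) (pfst (psnd z)) (psnd (psnd z))}"
    by (simp add: decidable_iff_dec)
  have "dec (\<lambda>z. R2 (pfst z) (pfst (psnd z)) (psnd (psnd z)))"
    unfolding R2_def by (intro comp_intros dec2[OF S'(1)] dec2[OF N'(1)] dec2[OF Q'(1)])
  then have R2: "decidable {z. R2 (pfst z) (pfst (psnd z)) (psnd (psnd z))}"
    by (simp add: decidable_iff_dec)
  have "(a, b) \<in> A \<longleftrightarrow> (\<exists>u. \<forall>v. R1 (prod_encode (a, b)) u v)" for a b
  proof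
    assume A: "(a, b) \<in> A"
    obtain u where u: "S (prod_encode (a, b)) u" "\<not> N (prod_encode (a, b)) u" using ex by blast
    then have "Q (prod_encode (a, b)) u" using iff A by blast
    then obtain y1 y2 where "S' (prod_encode (prod_encode (a, b), u)) y1"
      "Q' (prod_encode (prod_encode (a, b), u)) y2"
      using u(1) unfolding S_iff Q_iff by blast
    then have "\<forall>v. R1 (prod_encode (a, b)) (prod_encode (u, prod_encode (y1, y2))) v"
      using u(2) unfolding N_iff R1_def by simp
    then show "\<exists>u. \<forall>v. R1 (prod_encode (a, b)) u v" by blast
  next
    assume "\<exists>u. \<forall>v. R1 (prod_encode (a, b)) u v"
    then obtain U where "\<forall>v. R1 (prod_encode (a, b)) U v" by blast
    then have "S (prod_encode (a, b)) (pfst U)" "\<not> N (prod_encode (a, b)) (pfst U)"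
      "Q (prod_encode (a, b)) (pfst U)"
      unfolding S_iff N_iff Q_iff R1_def by blast+
    then show "(a, b) \<in> A" using iff by blast
  qed
  then have "A = {(x, y). \<exists>u. \<forall>v. prod_encode (prod_encode (x, y), prod_encode (u, v)) \<in>
      {z. R1 (pfst z) (pfst (psnd z)) (psnd (psnd z))}}"
    by (simp add: set_eq_iff)
  then have "Sigma02 A" unfolding Sigma02_def using R1 by blast
  have "(a, b) \<in> A \<longleftrightarrow> (\<forall>u. \<exists>v. R2 (prod_encode (a, b)) u v)" for a b
  proof
    assume A: "(a, b) \<in> A"
    show "\<forall>u. \<exists>v. R2 (prod_encode (a, b)) u v"
    proof
      fix U
      show "\<exists>v. R2 (prod_encode (a, b)) U v"
        using iff[of a b "pfst U"] A unfolding R2_def S_iff N_iff Q_iff by blast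
    qed
  next
    assume R: "\<forall>u. \<exists>v. R2 (prod_encode (a, b)) u v"
    obtain u where u: "S (prod_encode (a, b)) u" "\<not> N (prod_encode (a, b)) u" using ex by blast
    then obtain y where "S' (prod_encode (prod_encode (a, b), u)) y" unfolding S_iff by blast
    moreover obtain v where "R2 (prod_encode (a, b)) (prod_encode (u, y)) v" using R by blast
    ultimately have "Q (prod_encode (a, b)) u"
      using u(2) unfolding R2_def N_iff Q_iff by auto
    then show "(a, b) \<in> A" using iff u by blast
  qed
  then have "A = {(x, y). \<forall>u. \<exists>v. prod_encode (prod_encode (x, y), prod_encode (u, v)) \<in>
      {z. R2 (pfst z) (pfst (psnd z)) (psnd (psnd z))}}"
    by (simp add: set_eq_iff)
  then have "Pi02 A" unfolding Pi02_def using R2 by blast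
  then show ?thesis using \<open>Sigma02 A\<close> by (simp add: Delta02_def)
qed

section \<open>Certificates for the evaluation of programs\<close>

text \<open>
  A certificate \<open>prod_encode (prod_encode (p, prod_encode (x, y)), L)\<close> carries a judgement (the
  program with code \<open>p\<close> maps \<open>x\<close> to \<open>y\<close>) and the list \<open>L\<close> of the certificates of its premises.
\<close>

definition premise :: "nat set \<Rightarrow> nat \<Rightarrow> nat \<Rightarrow> nat \<Rightarrow> nat \<Rightarrow> nat \<Rightarrow> bool" where
  "premise T L i p x y \<longleftrightarrow>
     nth_code L i \<in> T \<and> pfst (nth_code L i) = prod_encode (p, prod_encode (x, y))"

definition premise_val :: "nat \<Rightarrow> nat \<Rightarrow> nat" where
  "premise_val L i = psnd (psnd (pfst (nth_code L i)))"

text \<open>Each disjunct is one rule of \<open>eval\<close>, recognised by the shape of the program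
  code. Intermediate values are read off the premises and \<open>q\<close> is bounded, which keeps
  the test decidable. Writing a value as \<open>Suc (premise_val L m - 1)\<close> demands that it be
  positive.\<close>

definition eval_step :: "nat set \<Rightarrow> nat \<Rightarrow> nat \<Rightarrow> nat \<Rightarrow> nat \<Rightarrow> bool" where
  "eval_step T L p x y \<longleftrightarrow>
     p = 0 \<and> y = 0 \<or> p = 1 \<and> y = Suc x \<or> p = 2 \<and> y = pfst x \<or> p = 3 \<and> y = psnd x \<or>
     (\<exists>q<p. p = 4 * q + 4 \<and>
        premise T L 0 (pfst q) x (pfst y) \<and> premise T L 1 (psnd q) x (psnd y)) \<or>
     (\<exists>q<p. p = 4 * q + 5 \<and>
        premise T L 0 (psnd q) x (premise_val L 0) \<and> premise T L 1 (pfst q) (premise_val L 0) y) \<or>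
     (\<exists>q<p. p = 4 * q + 6 \<and> psnd x = 0 \<and> premise T L 0 (pfst q) (pfst x) y) \<or>
     (\<exists>q<p. p = 4 * q + 6 \<and> psnd x \<noteq> 0 \<and>
        premise T L 0 p (prod_encode (pfst x, psnd x - 1)) (premise_val L 0) \<and>
        premise T L 1 (psnd q) (prod_encode (pfst x, prod_encode (psnd x - 1, premise_val L 0))) y) \<or>
     (\<exists>q<p. p = 4 * q + 7 \<and> premise T L y q (prod_encode (x, y)) 0 \<and>
        (\<forall>m<y. premise T L m q (prod_encode (x, m)) (Suc (premise_val L m - 1))))"

lemma computable_premise_val [comp_intros]:
  assumes "computable L" "computable i"
  shows "computable (\<lambda>z. premise_val (L z) (i z))"
  unfolding premise_val_def by (intro comp_intros assms)

lemma dec_premise [comp_intros]: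
  assumes "computable T" "computable L" "computable i" "computable p" "computable x" "computable y"
  shows "dec (\<lambda>z. premise (set_decode (T z)) (L z) (i z) (p z) (x z) (y z))"
  unfolding premise_def by (intro comp_intros assms)

lemma dec_eval_step:
  "dec (\<lambda>w. eval_step (set_decode (psnd (psnd w))) (psnd (pfst (psnd w)))
     (pfst (pfst (pfst (psnd w)))) (pfst (psnd (pfst (pfst (psnd w)))))
     (psnd (psnd (pfst (pfst (psnd w))))))"
  unfolding eval_step_def by (intro comp_intros)

definition eval_code :: "nat \<Rightarrow> nat \<Rightarrow> nat \<Rightarrow> bool" where
  "eval_code p x y \<longleftrightarrow> (\<exists>p'. prog_code p' = p \<and> eval p' x y)"

lemma eval_code_step:
  assumes "eval_step T L p x y"
    and T: "\<And>i q a b. premise T L i q a b \<Longrightarrow> eval_code q a b"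
  shows "eval_code p x y"
proof -
  note assms(1)[unfolded eval_step_def]
  then consider "p = 0" "y = 0" | "p = 1" "y = Suc x" | "p = 2" "y = pfst x" | "p = 3" "y = psnd x"
    | q where "p = 4 * q + 4" "premise T L 0 (pfst q) x (pfst y)" "premise T L 1 (psnd q) x (psnd y)"
    | q where "p = 4 * q + 5" "premise T L 0 (psnd q) x (premise_val L 0)"
        "premise T L 1 (pfst q) (premise_val L 0) y"
    | q where "p = 4 * q + 6" "psnd x = 0" "premise T L 0 (pfst q) (pfst x) y"
    | q where "p = 4 * q + 6" "psnd x \<noteq> 0"
        "premise T L 0 p (prod_encode (pfst x, psnd x - 1)) (premise_val L 0)"
        "premise T L 1 (psnd q) (prod_encode (pfst x, prod_encode (psnd x - 1, premise_val L 0))) y"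
    | q where "p = 4 * q + 7" "premise T L y q (prod_encode (x, y)) 0"
        "\<forall>m<y. premise T L m q (prod_encode (x, m)) (Suc (premise_val L m - 1))"
    by (elim disjE exE conjE) blast+
  then show ?thesis
  proof cases
    case 1
    then have "prog_code CZero = p \<and> eval CZero x y" by (simp add: eval.zero)
    then show ?thesis unfolding eval_code_def by blast
  next
    case 2
    then have "prog_code CSucc = p \<and> eval CSucc x y" by (simp add: eval.succ)
    then show ?thesis unfolding eval_code_def by blast
  next
    case 3
    then have "prog_code CFst = p \<and> eval CFst x y"
      using eval.fst[of "pfst x" "psnd x"] by simp
    then show ?thesis unfolding eval_code_def by blast
  next
    case 4
    then have "prog_code CSnd = p \<and> eval CSnd x y"
      using eval.snd[of "pfst x" "psnd x"] by simp
    then show ?thesis unfolding eval_code_def by blast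
  next
    case (5 q)
    obtain p1 p2 where "prog_code p1 = pfst q" "eval p1 x (pfst y)"
      "prog_code p2 = psnd q" "eval p2 x (psnd y)"
      using T[OF 5(2)] T[OF 5(3)] unfolding eval_code_def by blast
    then have "prog_code (CPair p1 p2) = p \<and> eval (CPair p1 p2) x y"
      using 5(1) eval.pair[of p1 x "pfst y" p2 "psnd y"] by simp
    then show ?thesis unfolding eval_code_def by blast
  next
    case (6 q)
    obtain p1 p2 where "prog_code p2 = psnd q" "eval p2 x (premise_val L 0)"
      "prog_code p1 = pfst q" "eval p1 (premise_val L 0) y"
      using T[OF 6(2)] T[OF 6(3)] unfolding eval_code_def by blast
    then have "prog_code (CComp p1 p2) = p \<and> eval (CComp p1 p2) x y"
      using 6(1) eval.comp[of p2 x _ p1 y] by simp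
    then show ?thesis unfolding eval_code_def by blast
  next
    case (7 q)
    \<comment> \<open>No premise mentions the step program of the recursion; surjectivity of the
      coding still supplies one with code \<open>psnd q\<close>.\<close>
    obtain p1 p2 where "prog_code p1 = pfst q" "eval p1 (pfst x) y" "prog_code p2 = psnd q"
      using T[OF 7(3)] prog_code_surj unfolding eval_code_def by blast
    then have "prog_code (CRec p1 p2) = p \<and> eval (CRec p1 p2) x y"
      using 7(1,2) eval.rec_0[of p1 "pfst x" y p2] prod_encode_pfst_psnd[of x] by simp
    then show ?thesis unfolding eval_code_def by blast
  next
    case (8 q)
    obtain r p2 where r: "prog_code r = p" "eval r (prod_encode (pfst x, psnd x - 1)) (premise_val L 0)"
      "prog_code p2 = psnd q"
      "eval p2 (prod_encode (pfst x, prod_encode (psnd x - 1, premise_val L 0))) y"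
      using T[OF 8(3)] T[OF 8(4)] unfolding eval_code_def by blast
    obtain p1 where "prog_code p1 = pfst q" using prog_code_surj by blast
    then have "prog_code (CRec p1 p2) = p" using 8(1) r(3) by simp
    \<comment> \<open>The premise only provides some program with code \<open>p\<close>; injectivity
      of the coding makes it the recursion just assembled.\<close>
    then have "r = CRec p1 p2" using r(1) prog_code_inj by metis
    then have "prog_code (CRec p1 p2) = p \<and> eval (CRec p1 p2) x y"
      using r 8(2) eval.rec_Suc[of p1 p2 "pfst x" "psnd x - 1" "premise_val L 0" y] by simp
    then show ?thesis unfolding eval_code_def by blast
  next
    case (9 q)
    obtain p1 where p1: "prog_code p1 = q" "eval p1 (prod_encode (x, y)) 0"
      using T[OF 9(2)] unfolding eval_code_def by blast
    \<comment> \<open>Each premise provides its own program with code \<open>q\<close>; injectivity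
      identifies all of them with \<open>p1\<close>.\<close>
    have "\<forall>m<y. \<exists>v. eval p1 (prod_encode (x, m)) (Suc v)"
      using 9(3) T p1(1) prog_code_inj unfolding eval_code_def by metis
    then have "prog_code (CMu p1) = p \<and> eval (CMu p1) x y"
      using 9(1) p1 by (simp add: eval.mu)
    then show ?thesis unfolding eval_code_def by blast
  qed
qed

text \<open>Completeness of certificates, by induction on the derivation. The certificates of the
  premises are put into a list; being smaller than the new certificate, they are available to its
  step. All that is asked of \<open>P\<close> is that it accepts justified certificates.\<close>

lemma eval_code_imp_certificate:
  assumes P: "\<And>c L. eval_step {m. m < prod_encode (c, L) \<and> P m} L (pfst c) (pfst (psnd c))
      (psnd (psnd c)) \<Longrightarrow> P (prod_encode (c, L))"
    and "eval p x y"
  shows "\<exists>L. P (prod_encode (prod_encode (prog_code p, prod_encode (x, y)), L))"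
proof -
  define cert where "cert p x y v \<longleftrightarrow> P v \<and> pfst v = prod_encode (p, prod_encode (x, y))" for p x y v
  have step: "\<exists>v. cert p x y v"
    if "eval_step {m. m < prod_encode (prod_encode (p, prod_encode (x, y)), list_encode vs) \<and> P m}
      (list_encode vs) p x y" for p x y vs
    using P[of "prod_encode (p, prod_encode (x, y))" "list_encode vs"] that
    by (auto simp: cert_def intro!: exI)
  have prem: "premise {m. m < prod_encode (c, list_encode vs) \<and> P m} (list_encode vs) i p x y"
    if "i < length vs" "cert p x y (vs ! i)" for c vs i p x y
    using that le_prod_encode_2[of "list_encode vs" c] nth_less_list_encode[of i vs]
    by (auto simp: premise_def cert_def nth_code_list_encode)
  have val: "premise_val (list_encode vs) i = y" if "i < length vs" "cert p x y (vs ! i)" for vs i p x y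
    using that by (simp add: premise_val_def cert_def nth_code_list_encode)
  have "\<exists>v. cert (prog_code p) x y v"
    using assms(2)
  proof (induction rule: eval.induct)
    case (zero x)
    show ?case by (rule step[of _ _ _ "[]"]) (simp add: eval_step_def)
  next
    case (succ x)
    show ?case by (rule step[of _ _ _ "[]"]) (simp add: eval_step_def)
  next
    case (fst a b)
    show ?case by (rule step[of _ _ _ "[]"]) (simp add: eval_step_def)
  next
    case (snd a b)
    show ?case by (rule step[of _ _ _ "[]"]) (simp add: eval_step_def)
  next
    case (pair p x a q b)
    then obtain v w where vw: "cert (prog_code p) x a v" "cert (prog_code q) x b w" by blast
    define r where "r = prod_encode (prog_code p, prog_code q)"
    note prem[of 0 "[v, w]" "prog_code p" x a] prem[of 1 "[v, w]" "prog_code q" x b]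
    then show ?case
      using vw by (intro step[of _ _ _ "[v, w]"], unfold eval_step_def)
        (rule disjI2, rule disjI2, rule disjI2, rule disjI2, rule disjI1, rule exI[of _ r], simp add: r_def)
  next
    case (comp q x y p z)
    then obtain v w where vw: "cert (prog_code q) x y v" "cert (prog_code p) y z w" by blast
    define r where "r = prod_encode (prog_code p, prog_code q)"
    note prem[of 0 "[v, w]" "prog_code q" x y] prem[of 1 "[v, w]" "prog_code p" y z]
      val[of 0 "[v, w]" "prog_code q" x y]
    then show ?case
      using vw by (intro step[of _ _ _ "[v, w]"], unfold eval_step_def)
        (rule disjI2, rule disjI2, rule disjI2, rule disjI2, rule disjI2, rule disjI1,
          rule exI[of _ r], simp add: r_def)
  next
    case (rec_0 p a y q)
    then obtain v where v: "cert (prog_code p) a y v" by blast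
    define r where "r = prod_encode (prog_code p, prog_code q)"
    note prem[of 0 "[v]" "prog_code p" a y]
    then show ?case
      using v by (intro step[of _ _ _ "[v]"], unfold eval_step_def)
        (rule disjI2, rule disjI2, rule disjI2, rule disjI2, rule disjI2, rule disjI2, rule disjI1,
          rule exI[of _ r], simp add: r_def)
  next
    case (rec_Suc p q a n y z)
    then obtain v w where vw: "cert (prog_code (CRec p q)) (prod_encode (a, n)) y v"
      "cert (prog_code q) (prod_encode (a, prod_encode (n, y))) z w" by blast
    define r where "r = prod_encode (prog_code p, prog_code q)"
    note prem[of 0 "[v, w]" "prog_code (CRec p q)" "prod_encode (a, n)" y]
      prem[of 1 "[v, w]" "prog_code q" "prod_encode (a, prod_encode (n, y))" z]
      val[of 0 "[v, w]" "prog_code (CRec p q)" "prod_encode (a, n)" y]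
    then show ?case
      using vw by (intro step[of _ _ _ "[v, w]"], unfold eval_step_def)
        (rule disjI2, rule disjI2, rule disjI2, rule disjI2, rule disjI2, rule disjI2, rule disjI2,
          rule disjI1, rule exI[of _ r], simp add: r_def)
  next
    case (mu p a n)
    then obtain v where v: "cert (prog_code p) (prod_encode (a, n)) 0 v" by blast
    obtain u y where u: "\<And>m. m < n \<Longrightarrow> cert (prog_code p) (prod_encode (a, m)) (Suc (y m)) (u m)"
      using mu by metis
    \<comment> \<open>Position \<open>m\<close> holds the certificate for the argument
      \<open>m\<close>, and position \<open>n\<close> the one for the zero found there, as the last
      case of \<open>eval_step\<close> expects.\<close>
    let ?vs = "map u [0..<n] @ [v]"
    have "premise_val (list_encode ?vs) m = Suc (y m)" if "m < n" for m
      using val[of m ?vs] u[OF that] that by (simp add: nth_append)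
    moreover note prem[of n ?vs] prem[of _ ?vs] u v
    ultimately show ?case
      by (intro step[of _ _ _ ?vs], unfold eval_step_def)
        (rule disjI2, rule disjI2, rule disjI2, rule disjI2, rule disjI2, rule disjI2, rule disjI2,
          rule disjI2, rule exI[of _ "prog_code p"], simp add: nth_append)
  qed
  then show ?thesis
    unfolding cert_def by (metis prod_encode_pfst_psnd)
qed

text \<open>A form of Kleene's normal form theorem: a program halts if and only if some number
  passes a decidable test, namely being a valid certificate. The first argument of \<open>P\<close>
  is a dummy parameter, set to 0.\<close>

lemma semidec_in_W [semidec_intros]:
  assumes "computable f" "computable g"
  shows "semidec (\<lambda>z. f z \<in> W (g z))"
proof -
  obtain P where dec: "dec (\<lambda>w. P (pfst w) (psnd w))"
    and P: "\<And>x w. P x w \<longleftrightarrow> eval_step {m. m < w \<and> P x m} (psnd w) (pfst (pfst w))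
      (pfst (psnd (pfst w))) (psnd (psnd (pfst w)))"
    using dec_course_of_values[of "\<lambda>x w T. eval_step T (psnd w) (pfst (pfst w))
      (pfst (psnd (pfst w))) (psnd (psnd (pfst w)))", OF dec_eval_step] by blast
  have sound: "eval_code (pfst (pfst w)) (pfst (psnd (pfst w))) (psnd (psnd (pfst w)))" if "P 0 w" for w
    using that
  proof (induction w rule: less_induct)
    case (less w)
    show ?case
    proof (rule eval_code_step[OF P[THEN iffD1, OF less.prems]])
      fix i q a b assume "premise {m. m < w \<and> P 0 m} (psnd w) i q a b"
      then show "eval_code q a b"
        using less.IH[of "nth_code (psnd w) i"] by (simp add: premise_def)
    qed
  qed
  have "x \<in> W e \<longleftrightarrow> (\<exists>y L. P 0 (prod_encode (prod_encode (e, prod_encode (x, y)), L)))" for x e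
  proof
    assume "x \<in> W e"
    then obtain p y where p: "prog_code p = e" "eval p x y" unfolding W_def by blast
    have "\<exists>L. P 0 (prod_encode (prod_encode (prog_code p, prod_encode (x, y)), L))"
      by (rule eval_code_imp_certificate[OF _ p(2)]) (subst P, simp)
    then show "\<exists>y L. P 0 (prod_encode (prod_encode (e, prod_encode (x, y)), L))"
      unfolding p(1) by blast
  next
    assume "\<exists>y L. P 0 (prod_encode (prod_encode (e, prod_encode (x, y)), L))"
    then obtain y L where "P 0 (prod_encode (prod_encode (e, prod_encode (x, y)), L))" by blast
    from sound[OF this] show "x \<in> W e" by (auto simp: W_def eval_code_def)
  qed
  moreover have "semidec (\<lambda>z. \<exists>y L. P 0 (prod_encode (prod_encode (g z, prod_encode (f z, y)), L)))"
    by (intro semidec_intros semidec_dec dec2[OF dec] comp_intros computable_comp[OF assms(1)]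
        computable_comp[OF assms(2)])
  ultimately show ?thesis by simp
qed

section \<open>Quotient algebras\<close>

text \<open>Operations of a quotient are unions over \<open>listset\<close>; this describes the
  tuples of representatives as those related entry by entry.\<close>

lemma listset_map_classes:
  "listset (map (\<lambda>a. r `` {a}) as) = {bs. list_all2 (\<lambda>a b. (a, b) \<in> r) as bs}"
  by (induction as) (auto simp: set_Cons_def list_all2_Cons1)

lemma oper_quotient_algebra:
  assumes "congruence sig A \<theta>" "f < length sig" "length as = sig ! f" "set as \<subseteq> carrier A"
  shows "oper (quotient_algebra A \<theta>) f (map (\<lambda>a. \<theta> `` {a}) as) = \<theta> `` {oper A f as}"
proof -
  have eq: "equiv (carrier A) \<theta>" using assms(1) by (simp add: congruence_def)
  have "list_all2 (\<lambda>a b. (a, b) \<in> \<theta>) as as"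
    using eq assms(4) by (auto simp: list_all2_conv_all_nth equiv_def refl_on_def subset_iff)
  moreover have "\<theta> `` {oper A f bs} = \<theta> `` {oper A f as}" if "list_all2 (\<lambda>a b. (a, b) \<in> \<theta>) as bs" for bs
  proof -
    have "(oper A f as, oper A f bs) \<in> \<theta>"
      using assms(1-3) that unfolding congruence_def by blast
    then show ?thesis using equiv_class_eq[OF eq] by blast
  qed
  ultimately have "(\<Union>bs\<in>{bs. list_all2 (\<lambda>a b. (a, b) \<in> \<theta>) as bs}. \<theta> `` {oper A f bs}) = \<theta> `` {oper A f as}"
    by blast
  then show ?thesis
    by (simp only: quotient_algebra_def algebra.select_convs listset_map_classes)
qed

lemma quotient_list_representatives:
  assumes "set Xs \<subseteq> A // r"
  obtains as where "set as \<subseteq> A" "Xs = map (\<lambda>a. r `` {a}) as"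
proof -
  have "\<exists>as. set as \<subseteq> A \<and> Xs = map (\<lambda>a. r `` {a}) as"
    using assms
  proof (induction Xs)
    case (Cons X Xs)
    then obtain as where "set as \<subseteq> A" "Xs = map (\<lambda>a. r `` {a}) as" by auto
    moreover obtain a where "a \<in> A" "X = r `` {a}"
      using Cons.prems by (auto elim: quotientE)
    ultimately have "set (a # as) \<subseteq> A \<and> X # Xs = map (\<lambda>a. r `` {a}) (a # as)" by simp
    then show ?case by (rule exI)
  qed simp
  then show ?thesis using that by blast
qed

section \<open>Substitutions and presentations\<close>

lemma carrier_term_algebra [simp]: "carrier (term_algebra sig k) = trms sig {..<k}"
  and oper_term_algebra [simp]: "oper (term_algebra sig k) = Op"
  by (simp_all add: term_algebra_def)

lemma subst_in_trms:
  assumes "t \<in> trms sig X" "\<And>i. i \<in> X \<Longrightarrow> \<sigma> i \<in> trms sig Y"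
  shows "subst \<sigma> t \<in> trms sig Y"
  using assms(1)
proof induction
  case (2 f ts)
  then show ?case using trms.intros(2)[of f sig "map (subst \<sigma>) ts" Y] by simp
qed (use assms(2) in simp)

lemma subst_subst: "subst \<sigma> (subst \<tau> t) = subst (\<lambda>i. subst \<sigma> (\<tau> i)) t"
  by (induction t) auto

lemma subst_Var: "subst Var t = t"
  by (induction t) (auto intro: map_idI)

locale well_formed_variety =
  fixes V :: variety
  assumes laws_well_formed: "laws V \<subseteq> trms (vsig V) UNIV \<times> trms (vsig V) UNIV"
begin

abbreviation T :: "nat \<Rightarrow> trm set" where
  "T k \<equiv> trms (vsig V) {..<k}"

text \<open>These relations correspond to the congruences of the free algebra of the variety on
  \<open>k\<close> generators; \<open>pres_cong\<close> is the least of them above a given set of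
  relations.\<close>

definition law_congruence :: "nat \<Rightarrow> (trm \<times> trm) set \<Rightarrow> bool" where
  "law_congruence k \<theta> \<longleftrightarrow>
     congruence (vsig V) (term_algebra (vsig V) k) \<theta> \<and> law_instances V k \<subseteq> \<theta>"

lemma law_congruence_equiv: "law_congruence k \<theta> \<Longrightarrow> equiv (T k) \<theta>"
  by (simp add: law_congruence_def congruence_def)

lemma law_congruence_subset: "law_congruence k \<theta> \<Longrightarrow> \<theta> \<subseteq> T k \<times> T k"
  by (rule equiv_type[OF law_congruence_equiv])

lemma law_congruence_refl: "law_congruence k \<theta> \<Longrightarrow> t \<in> T k \<Longrightarrow> (t, t) \<in> \<theta>"
  using law_congruence_equiv by (auto simp: equiv_def refl_on_def)

lemma law_congruence_sym: "law_congruence k \<theta> \<Longrightarrow> (s, t) \<in> \<theta> \<Longrightarrow> (t, s) \<in> \<theta>"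
  using law_congruence_equiv by (auto simp: equiv_def dest: symD)

lemma law_congruence_trans:
  "law_congruence k \<theta> \<Longrightarrow> (s, t) \<in> \<theta> \<Longrightarrow> (t, u) \<in> \<theta> \<Longrightarrow> (s, u) \<in> \<theta>"
  using law_congruence_equiv by (auto simp: equiv_def dest: transD)

lemma law_congruence_Op:
  assumes "law_congruence k \<theta>" "f < length (vsig V)" "length as = vsig V ! f"
    "list_all2 (\<lambda>a b. (a, b) \<in> \<theta>) as bs"
  shows "(Op f as, Op f bs) \<in> \<theta>"
  using assms unfolding law_congruence_def congruence_def by auto

lemma law_congruenceI:
  assumes "\<theta> \<subseteq> T k \<times> T k" "\<And>t. t \<in> T k \<Longrightarrow> (t, t) \<in> \<theta>" "\<And>s t. (s, t) \<in> \<theta> \<Longrightarrow> (t, s) \<in> \<theta>"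
    "\<And>s t u. (s, t) \<in> \<theta> \<Longrightarrow> (t, u) \<in> \<theta> \<Longrightarrow> (s, u) \<in> \<theta>"
    "\<And>f as bs. f < length (vsig V) \<Longrightarrow> length as = vsig V ! f \<Longrightarrow>
       list_all2 (\<lambda>a b. (a, b) \<in> \<theta>) as bs \<Longrightarrow> (Op f as, Op f bs) \<in> \<theta>"
    "law_instances V k \<subseteq> \<theta>"
  shows "law_congruence k \<theta>"
proof -
  have "equiv (T k) \<theta>"
    by (intro equivI refl_onI symI transI) (fact assms)+
  moreover have "\<forall>f as bs. f < length (vsig V) \<and> length as = vsig V ! f \<and>
      list_all2 (\<lambda>a b. (a, b) \<in> \<theta>) as bs \<longrightarrow> (Op f as, Op f bs) \<in> \<theta>"
    by (intro allI impI, elim conjE) (rule assms(5))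
  ultimately show ?thesis
    unfolding law_congruence_def congruence_def using assms(6) by simp
qed

lemma law_congruence_subst:
  assumes "law_congruence j \<theta>" "\<And>i. i < k \<Longrightarrow> (\<sigma> i, \<tau> i) \<in> \<theta>" "t \<in> T k"
  shows "(subst \<sigma> t, subst \<tau> t) \<in> \<theta>"
  using assms(3)
proof induction
  case (2 f ts)
  then show ?case
    by (auto intro!: law_congruence_Op[OF assms(1)] simp: list_all2_conv_all_nth)
qed (use assms(2) in auto)

lemma law_instances_subset: "law_instances V k \<subseteq> T k \<times> T k"
  unfolding law_instances_def using laws_well_formed by (auto intro!: subst_in_trms)

text \<open>The pulled back relation is the kernel of the map from \<open>T k\<close> to
  \<open>T j\<close> modulo \<open>\<theta>\<close> induced by \<open>\<sigma>\<close>. It contains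
  the law instances because applying \<open>\<sigma>\<close> to an instance of a law composes two
  substitutions and yields an instance again.\<close>

lemma pullback_law_congruence:
  assumes \<theta>: "law_congruence j \<theta>" and \<sigma>: "\<And>i. i < k \<Longrightarrow> \<sigma> i \<in> T j"
  shows "law_congruence k {(s, t). s \<in> T k \<and> t \<in> T k \<and> (subst \<sigma> s, subst \<sigma> t) \<in> \<theta>}"
    (is "law_congruence k ?\<phi>")
proof (rule law_congruenceI)
  show "(Op f as, Op f bs) \<in> ?\<phi>"
    if f: "f < length (vsig V)" "length as = vsig V ! f"
      and l: "list_all2 (\<lambda>a b. (a, b) \<in> ?\<phi>) as bs" for f as bs
  proof -
    have "set as \<subseteq> T k" "set bs \<subseteq> T k" "length bs = length as"
      "list_all2 (\<lambda>a b. (a, b) \<in> \<theta>) (map (subst \<sigma>) as) (map (subst \<sigma>) bs)"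
      using l by (auto simp: list_all2_conv_all_nth in_set_conv_nth)
    then show ?thesis
      using f law_congruence_Op[OF \<theta>, of f "map (subst \<sigma>) as" "map (subst \<sigma>) bs"]
      by (auto intro!: trms.intros)
  qed
  show "law_instances V k \<subseteq> ?\<phi>"
  proof
    fix p assume p: "p \<in> law_instances V k"
    then obtain \<rho> l r where lr: "p = (subst \<rho> l, subst \<rho> r)" "(l, r) \<in> laws V" "\<And>i. \<rho> i \<in> T k"
      by (auto simp: law_instances_def)
    have "\<And>i. subst \<sigma> (\<rho> i) \<in> T j"
      using lr(3) \<sigma> by (auto intro: subst_in_trms)
    then have "(subst \<sigma> (subst \<rho> l), subst \<sigma> (subst \<rho> r)) \<in> law_instances V j"
      unfolding subst_subst law_instances_def using lr(2) by blast
    then show "p \<in> ?\<phi>"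
      using \<theta> p lr(1) law_instances_subset[of k] by (auto simp: law_congruence_def)
  qed
qed (auto intro: law_congruence_refl[OF \<theta>] law_congruence_sym[OF \<theta>] law_congruence_trans[OF \<theta>]
    subst_in_trms \<sigma>)

text \<open>This ensures that the family intersected in \<open>pres_cong\<close> is
  nonempty.\<close>

lemma law_congruence_full: "law_congruence k (T k \<times> T k)"
  using law_instances_subset
  by (intro law_congruenceI) (auto intro!: trms.intros simp: list_all2_conv_all_nth in_set_conv_nth)

lemma law_congruence_Inter:
  assumes "\<And>\<theta>. \<theta> \<in> C \<Longrightarrow> law_congruence k \<theta>" "C \<noteq> {}"
  shows "law_congruence k (\<Inter>C)"
proof (rule law_congruenceI)
  show "(Op f as, Op f bs) \<in> \<Inter>C"
    if "f < length (vsig V)" "length as = vsig V ! f" "list_all2 (\<lambda>a b. (a, b) \<in> \<Inter>C) as bs"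
    for f as bs
  proof
    fix \<theta> assume "\<theta> \<in> C"
    then have "list_all2 (\<lambda>a b. (a, b) \<in> \<theta>) as bs"
      using that(3) by (auto elim: list_all2_mono)
    then show "(Op f as, Op f bs) \<in> \<theta>"
      using law_congruence_Op assms(1) \<open>\<theta> \<in> C\<close> that by blast
  qed
  show "law_instances V k \<subseteq> \<Inter>C" using assms by (auto simp: law_congruence_def)
  show "\<Inter>C \<subseteq> T k \<times> T k" using assms law_congruence_subset by blast
qed (use assms in \<open>blast intro: law_congruence_refl law_congruence_sym law_congruence_trans\<close>)+

lemma
  assumes "R \<subseteq> trm_pairs (vsig V) k"
  shows law_congruence_pres_cong: "law_congruence k (pres_cong V k R)"
    and pres_cong_superset: "R \<subseteq> pres_cong V k R"
proof -
  have eq: "pres_cong V k R = \<Inter>{\<theta>. law_congruence k \<theta> \<and> R \<subseteq> \<theta>}"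
    unfolding pres_cong_def law_congruence_def by (rule arg_cong[where f = Inter]) auto
  show "law_congruence k (pres_cong V k R)"
    unfolding eq using law_congruence_full[of k] assms
    by (intro law_congruence_Inter) (auto simp: trm_pairs_def)
  show "R \<subseteq> pres_cong V k R" unfolding eq by blast
qed

lemma pres_cong_least: "law_congruence k \<theta> \<Longrightarrow> R \<subseteq> \<theta> \<Longrightarrow> pres_cong V k R \<subseteq> \<theta>"
  unfolding pres_cong_def law_congruence_def by blast

lemma pres_cong_mono: "R \<subseteq> S \<Longrightarrow> pres_cong V k R \<subseteq> pres_cong V k S"
  unfolding pres_cong_def by blast

section \<open>Isomorphisms of presented algebras\<close>

text \<open>A homomorphism between presented algebras, given by terms representing the images of the
  generators. Only the relations in \<open>R\<close> are checked, a finite task when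
  \<open>R\<close> is finite.\<close>

definition pres_hom :: "nat \<Rightarrow> (trm \<times> trm) set \<Rightarrow> nat \<Rightarrow> (trm \<times> trm) set \<Rightarrow> (nat \<Rightarrow> trm) \<Rightarrow> bool"
  where "pres_hom k R j S \<sigma> \<longleftrightarrow> (\<forall>i<k. \<sigma> i \<in> T j) \<and>
    (\<forall>(s, t)\<in>R. (subst \<sigma> s, subst \<sigma> t) \<in> pres_cong V j S)"

text \<open>The pullback of \<open>pres_cong V j S\<close> along \<open>\<sigma>\<close> is a
  congruence containing \<open>R\<close> and the law instances, hence lies above the least such
  congruence.\<close>

lemma pres_hom_subst:
  assumes "pres_hom k R j S \<sigma>" "R \<subseteq> trm_pairs (vsig V) k" "S \<subseteq> trm_pairs (vsig V) j"
    "(s, t) \<in> pres_cong V k R"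
  shows "(subst \<sigma> s, subst \<sigma> t) \<in> pres_cong V j S"
proof -
  have "pres_cong V k R \<subseteq> {(s, t). s \<in> T k \<and> t \<in> T k \<and> (subst \<sigma> s, subst \<sigma> t) \<in> pres_cong V j S}"
    using assms(1-3)
    by (intro pres_cong_least[OF pullback_law_congruence[OF law_congruence_pres_cong[OF assms(3)]]])
      (auto simp: pres_hom_def trm_pairs_def)
  then show ?thesis using assms(4) by blast
qed

definition presentations_inverse ::
  "nat \<Rightarrow> (trm \<times> trm) set \<Rightarrow> nat \<Rightarrow> (trm \<times> trm) set \<Rightarrow> (nat \<Rightarrow> trm) \<Rightarrow> (nat \<Rightarrow> trm) \<Rightarrow> bool"
  where "presentations_inverse k R j S \<sigma> \<tau> \<longleftrightarrow> pres_hom k R j S \<sigma> \<and> pres_hom j S k R \<tau> \<and>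
    (\<forall>i<k. (subst \<tau> (\<sigma> i), Var i) \<in> pres_cong V k R) \<and>
    (\<forall>i<j. (subst \<sigma> (\<tau> i), Var i) \<in> pres_cong V j S)"

lemma presentations_inverse_subst:
  assumes "presentations_inverse k R j S \<sigma> \<tau>" "R \<subseteq> trm_pairs (vsig V) k" "t \<in> T k"
  shows "(subst \<tau> (subst \<sigma> t), t) \<in> pres_cong V k R"
  using law_congruence_subst[OF law_congruence_pres_cong[OF assms(2)], of k "\<lambda>i. subst \<tau> (\<sigma> i)" Var t] assms
  by (simp add: presentations_inverse_def subst_subst subst_Var)

lemma presentations_inverse_sym:
  "presentations_inverse k R j S \<sigma> \<tau> \<Longrightarrow> presentations_inverse j S k R \<tau> \<sigma>"
  by (simp add: presentations_inverse_def)

lemma carrier_presented: "carrier (presented V k R) = T k // pres_cong V k R"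
  by (simp add: presented_def quotient_algebra_def)

lemma oper_presented:
  assumes "R \<subseteq> trm_pairs (vsig V) k" "f < length (vsig V)" "length as = vsig V ! f" "set as \<subseteq> T k"
  shows "oper (presented V k R) f (map (\<lambda>a. pres_cong V k R `` {a}) as) = pres_cong V k R `` {Op f as}"
  using oper_quotient_algebra[of "vsig V" "term_algebra (vsig V) k" "pres_cong V k R" f as]
    law_congruence_pres_cong[OF assms(1)] assms
  by (simp add: presented_def law_congruence_def)

lemma presentations_inverse_imp_isomorphic:
  assumes inv: "presentations_inverse k R j S \<sigma> \<tau>"
    and R: "R \<subseteq> trm_pairs (vsig V) k" and S: "S \<subseteq> trm_pairs (vsig V) j"
  shows "isomorphic (vsig V) (presented V k R) (presented V j S)"
proof -
  \<comment> \<open>Closing the image of a whole class under the congruence avoids choosing a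
    representative. The data are parameters of \<open>h\<close> so that the facts below serve for
    \<open>\<sigma>\<close> and, by symmetry, for \<open>\<tau>\<close>.\<close>
  define h where "h k R \<sigma> X = pres_cong V k R `` (subst \<sigma> ` X)" for k R \<sigma> X
  have h_class: "h j S \<sigma> (pres_cong V k R `` {s}) = pres_cong V j S `` {subst \<sigma> s}"
    if inv: "presentations_inverse k R j S \<sigma> \<tau>"
    and R: "R \<subseteq> trm_pairs (vsig V) k" and S: "S \<subseteq> trm_pairs (vsig V) j" and s: "s \<in> T k"
    for k R j S \<sigma> \<tau> s
  proof -
    have hom: "pres_hom k R j S \<sigma>" using inv by (simp add: presentations_inverse_def)
    note S' = law_congruence_pres_cong[OF S]
    note ss = law_congruence_refl[OF law_congruence_pres_cong[OF R] s]
    show ?thesis unfolding h_def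
      using pres_hom_subst[OF hom R S] ss
        law_congruence_trans[OF S'] by blast
  qed
  have h_inv: "h k R \<tau> (h j S \<sigma> X) = X" "h j S \<sigma> X \<in> T j // pres_cong V j S"
    if inv: "presentations_inverse k R j S \<sigma> \<tau>"
    and R: "R \<subseteq> trm_pairs (vsig V) k" and S: "S \<subseteq> trm_pairs (vsig V) j"
    and X: "X \<in> T k // pres_cong V k R"
    for k R j S \<sigma> \<tau> X
  proof -
    obtain s where s: "s \<in> T k" "X = pres_cong V k R `` {s}" using X by (rule quotientE)
    have \<sigma>s: "subst \<sigma> s \<in> T j"
      using inv s(1) by (auto simp: presentations_inverse_def pres_hom_def intro: subst_in_trms)
    then show "h j S \<sigma> X \<in> T j // pres_cong V j S"
      unfolding s(2) h_class[OF inv R S s(1)] by (rule quotientI)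
    show "h k R \<tau> (h j S \<sigma> X) = X"
      unfolding s(2) h_class[OF inv R S s(1)] h_class[OF presentations_inverse_sym[OF inv] S R \<sigma>s]
      by (rule equiv_class_eq[OF law_congruence_equiv[OF law_congruence_pres_cong[OF R]]
            presentations_inverse_subst[OF inv R s(1)]])
  qed
  have "bij_betw (h j S \<sigma>) (T k // pres_cong V k R) (T j // pres_cong V j S)"
    using h_inv[OF inv R S] h_inv[OF presentations_inverse_sym[OF inv] S R]
    by (intro bij_betw_byWitness[where f' = "h k R \<tau>"]) auto
  moreover have "h j S \<sigma> (oper (presented V k R) f Xs) = oper (presented V j S) f (map (h j S \<sigma>) Xs)"
    if f: "f < length (vsig V)" "length Xs = vsig V ! f" and Xs: "set Xs \<subseteq> T k // pres_cong V k R" for f Xs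
  proof -
    obtain ss where ss: "set ss \<subseteq> T k" "Xs = map (\<lambda>a. pres_cong V k R `` {a}) ss"
      using Xs by (rule quotient_list_representatives)
    have len: "length ss = vsig V ! f" using f ss(2) by simp
    have map: "map (h j S \<sigma>) Xs = map (\<lambda>a. pres_cong V j S `` {a}) (map (subst \<sigma>) ss)"
      unfolding ss(2) using ss(1) h_class[OF inv R S] by auto
    have \<sigma>ss: "set (map (subst \<sigma>) ss) \<subseteq> T j" "length (map (subst \<sigma>) ss) = vsig V ! f"
      using inv ss(1) len by (auto simp: presentations_inverse_def pres_hom_def intro!: subst_in_trms)
    have "Op f ss \<in> T k" using f len ss(1) by (auto intro: trms.intros)
    then have "h j S \<sigma> (oper (presented V k R) f Xs) = pres_cong V j S `` {Op f (map (subst \<sigma>) ss)}"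
      using h_class[OF inv R S, of "Op f ss"] oper_presented[OF R f(1) len ss(1)]
      by (simp only: ss(2) subst.simps)
    also have "\<dots> = oper (presented V j S) f (map (h j S \<sigma>) Xs)"
      unfolding map using oper_presented[OF S f(1) \<sigma>ss(2,1)] by (rule sym)
    finally show ?thesis .
  qed
  ultimately show ?thesis
    unfolding isomorphic_def carrier_presented by blast
qed

text \<open>\<open>\<sigma>\<close> picks a representative of the image of each generator; induction
  on terms then shows that \<open>h\<close> is the map induced by \<open>\<sigma>\<close>.\<close>

lemma hom_imp_subst:
  assumes h: "\<And>X. X \<in> T k // pres_cong V k R \<Longrightarrow> h X \<in> T j // pres_cong V j S"
    and op: "\<And>f Xs. f < length (vsig V) \<Longrightarrow> length Xs = vsig V ! f \<Longrightarrow>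
      set Xs \<subseteq> T k // pres_cong V k R \<Longrightarrow>
      h (oper (presented V k R) f Xs) = oper (presented V j S) f (map h Xs)"
    and R: "R \<subseteq> trm_pairs (vsig V) k" and S: "S \<subseteq> trm_pairs (vsig V) j"
  obtains \<sigma> where "pres_hom k R j S \<sigma>"
    "\<And>s. s \<in> T k \<Longrightarrow> h (pres_cong V k R `` {s}) = pres_cong V j S `` {subst \<sigma> s}"
proof -
  have "\<exists>t. t \<in> T j \<and> h (pres_cong V k R `` {Var i}) = pres_cong V j S `` {t}" if "i < k" for i
  proof -
    have "Var i \<in> T k" using that by (auto intro: trms.intros)
    then show ?thesis using h[OF quotientI] by (metis quotientE)
  qed
  then obtain \<sigma> where \<sigma>: "\<And>i. i < k \<Longrightarrow> \<sigma> i \<in> T j"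
    "\<And>i. i < k \<Longrightarrow> h (pres_cong V k R `` {Var i}) = pres_cong V j S `` {\<sigma> i}" by metis
  have \<sigma>_class: "h (pres_cong V k R `` {s}) = pres_cong V j S `` {subst \<sigma> s}" if "s \<in> T k" for s
    using that
  proof induction
    case (2 f ts)
    then have ts: "set ts \<subseteq> T k" by auto
    then have "set (map (\<lambda>a. pres_cong V k R `` {a}) ts) \<subseteq> T k // pres_cong V k R"
      by (auto intro: quotientI)
    moreover have map: "map h (map (\<lambda>a. pres_cong V k R `` {a}) ts) =
        map (\<lambda>a. pres_cong V j S `` {a}) (map (subst \<sigma>) ts)"
      using 2 by auto
    ultimately have "h (oper (presented V k R) f (map (\<lambda>a. pres_cong V k R `` {a}) ts)) =
        oper (presented V j S) f (map (\<lambda>a. pres_cong V j S `` {a}) (map (subst \<sigma>) ts))"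
      using op[OF 2(1), of "map (\<lambda>a. pres_cong V k R `` {a}) ts"] 2(2) by (simp only: length_map)
    moreover have "set (map (subst \<sigma>) ts) \<subseteq> T j" using ts \<sigma>(1) by (auto intro: subst_in_trms)
    ultimately show ?case
      using oper_presented[OF R 2(1,2) ts] oper_presented[OF S 2(1), of "map (subst \<sigma>) ts"] 2(2)
      by (simp only: length_map subst.simps)
  qed (use \<sigma>(2) in auto)
  have "(subst \<sigma> s, subst \<sigma> t) \<in> pres_cong V j S" if "(s, t) \<in> R" for s t
  proof -
    have st: "s \<in> T k" "t \<in> T k" using that R by (auto simp: trm_pairs_def)
    have "pres_cong V k R `` {s} = pres_cong V k R `` {t}"
      using that pres_cong_superset[OF R]
        equiv_class_eq[OF law_congruence_equiv[OF law_congruence_pres_cong[OF R]]] by blast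
    then have "pres_cong V j S `` {subst \<sigma> s} = pres_cong V j S `` {subst \<sigma> t}"
      using \<sigma>_class st by metis
    moreover have "subst \<sigma> t \<in> T j" using st(2) \<sigma>(1) by (auto intro: subst_in_trms)
    ultimately show ?thesis
      by (rule eq_equiv_class[OF _ law_congruence_equiv[OF law_congruence_pres_cong[OF S]]])
  qed
  then have "pres_hom k R j S \<sigma>" using \<sigma>(1) by (auto simp: pres_hom_def)
  then show ?thesis using that \<sigma>_class by blast
qed

lemma isomorphic_imp_presentations_inverse:
  assumes "isomorphic (vsig V) (presented V k R) (presented V j S)"
    and R: "R \<subseteq> trm_pairs (vsig V) k" and S: "S \<subseteq> trm_pairs (vsig V) j"
  obtains \<sigma> \<tau> where "presentations_inverse k R j S \<sigma> \<tau>"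
proof -
  obtain h where bij: "bij_betw h (T k // pres_cong V k R) (T j // pres_cong V j S)"
    and op: "\<And>f Xs. f < length (vsig V) \<Longrightarrow> length Xs = vsig V ! f \<Longrightarrow>
      set Xs \<subseteq> T k // pres_cong V k R \<Longrightarrow>
      h (oper (presented V k R) f Xs) = oper (presented V j S) f (map h Xs)"
    using assms(1) unfolding isomorphic_def carrier_presented by blast
  define g where "g = inv_into (T k // pres_cong V k R) h"
  have gh: "g (h X) = X" if "X \<in> T k // pres_cong V k R" for X
    unfolding g_def by (rule bij_betw_inv_into_left[OF bij that])
  have hg: "h (g Y) = Y" if "Y \<in> T j // pres_cong V j S" for Y
    unfolding g_def by (rule bij_betw_inv_into_right[OF bij that])
  have g_in: "g Y \<in> T k // pres_cong V k R" if "Y \<in> T j // pres_cong V j S" for Y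
    using bij_betw_inv_into[OF bij] that unfolding g_def by (auto dest: bij_betwE)
  have h_in: "h X \<in> T j // pres_cong V j S" if "X \<in> T k // pres_cong V k R" for X
    using bij that by (auto dest: bij_betwE)
  have g_op: "g (oper (presented V j S) f Ys) = oper (presented V k R) f (map g Ys)"
    if f: "f < length (vsig V)" "length Ys = vsig V ! f" and Ys: "set Ys \<subseteq> T j // pres_cong V j S" for f Ys
  proof -
    have gYs: "set (map g Ys) \<subseteq> T k // pres_cong V k R" using Ys g_in by auto
    obtain ss where ss: "set ss \<subseteq> T k" "map g Ys = map (\<lambda>a. pres_cong V k R `` {a}) ss"
      using gYs by (rule quotient_list_representatives)
    have len: "length ss = vsig V ! f" using f(2) ss(2) by (metis length_map)
    \<comment> \<open>The result must be known to lie in the carrier before \<open>g\<close> can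
      cancel \<open>h\<close> on it; this is seen through representatives.\<close>
    have "oper (presented V k R) f (map g Ys) = pres_cong V k R `` {Op f ss}"
      unfolding ss(2) by (rule oper_presented[OF R f(1) len ss(1)])
    also have "\<dots> \<in> T k // pres_cong V k R"
      using f(1) len ss(1) by (auto intro!: quotientI trms.intros)
    finally have "g (h (oper (presented V k R) f (map g Ys))) = oper (presented V k R) f (map g Ys)"
      by (rule gh)
    moreover have "h (oper (presented V k R) f (map g Ys)) = oper (presented V j S) f Ys"
    proof -
      have "map h (map g Ys) = Ys" using hg Ys by (auto intro!: map_idI)
      then show ?thesis using op[OF f(1), of "map g Ys"] f(2) gYs by simp
    qed
    ultimately show ?thesis by simp
  qed
  obtain \<sigma> where \<sigma>: "pres_hom k R j S \<sigma>"
    "\<And>s. s \<in> T k \<Longrightarrow> h (pres_cong V k R `` {s}) = pres_cong V j S `` {subst \<sigma> s}"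
    using hom_imp_subst[OF h_in op R S] by blast
  obtain \<tau> where \<tau>: "pres_hom j S k R \<tau>"
    "\<And>s. s \<in> T j \<Longrightarrow> g (pres_cong V j S `` {s}) = pres_cong V k R `` {subst \<tau> s}"
    using hom_imp_subst[OF g_in g_op S R] by blast
  have "(subst \<tau> (\<sigma> i), Var i) \<in> pres_cong V k R" if "i < k" for i
  proof -
    have *: "Var i \<in> T k" "\<sigma> i \<in> T j" using that \<sigma>(1) by (auto simp: pres_hom_def intro: trms.intros)
    have "pres_cong V k R `` {subst \<tau> (\<sigma> i)} = pres_cong V k R `` {Var i}"
      using \<sigma>(2)[OF *(1)] \<tau>(2)[OF *(2)] gh[OF quotientI[OF *(1)]] by simp
    then show ?thesis
      by (rule eq_equiv_class[OF _ law_congruence_equiv[OF law_congruence_pres_cong[OF R]] *(1)])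
  qed
  moreover have "(subst \<sigma> (\<tau> i), Var i) \<in> pres_cong V j S" if "i < j" for i
  proof -
    have *: "Var i \<in> T j" "\<tau> i \<in> T k" using that \<tau>(1) by (auto simp: pres_hom_def intro: trms.intros)
    have "pres_cong V j S `` {subst \<sigma> (\<tau> i)} = pres_cong V j S `` {Var i}"
      using \<tau>(2)[OF *(1)] \<sigma>(2)[OF *(2)] hg[OF quotientI[OF *(1)]] by simp
    then show ?thesis
      by (rule eq_equiv_class[OF _ law_congruence_equiv[OF law_congruence_pres_cong[OF S]] *(1)])
  qed
  ultimately show ?thesis using that \<sigma>(1) \<tau>(1) unfolding presentations_inverse_def by blast
qed

section \<open>Consequences of the ascending chain condition\<close>

text \<open>An instance of the correspondence theorem. The chain condition speaks about quotient
  algebras, so the chain on terms is pushed down to the free algebra. Nothing is lost, since every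
  \<open>D n\<close> contains the congruence defining the free algebra and can be recovered from its
  image.\<close>

lemma law_congruence_chain_stabilizes:
  assumes acc: "Vfg_acc V" and k: "1 \<le> k"
    and D: "\<And>n. law_congruence k (D n)" "\<And>n. D n \<subseteq> D (Suc n)"
  obtains N where "\<And>n. n \<ge> N \<Longrightarrow> D n = D N"
proof -
  \<comment> \<open>An index of the empty set, so that the ascending chain condition applies to the free algebra.\<close>
  define p where "p = CMu (CComp CSucc CZero)"
  \<comment> \<open>The function searched by \<open>p\<close> is constantly 1, so the search never
    succeeds.\<close>
  have no_zero: "\<not> eval (CComp CSucc CZero) x 0" for x
    by (auto elim: eval.cases)
  have "\<not> eval p x y" for x y
    unfolding p_def using no_zero by (auto elim: eval.cases)
  then have "W (prog_code p) = {}"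
    unfolding W_def using prog_code_inj by blast
  then have "Vfg V k (prog_code p) = presented V k {}"
    by (simp add: Vfg_def decode_rels_def)
  then have acc: "acc_congruences (vsig V) (presented V k {})"
    using acc k unfolding Vfg_acc_def by metis
  define \<theta> where "\<theta> = pres_cong V k {}"
  have \<theta>: "law_congruence k \<theta>" unfolding \<theta>_def by (rule law_congruence_pres_cong) simp
  have \<theta>D: "\<theta> \<subseteq> D n" for n unfolding \<theta>_def by (rule pres_cong_least[OF D(1)]) simp
  define C where "C n = {(\<theta> `` {s}, \<theta> `` {t}) | s t. (s, t) \<in> D n}" for n
  have D_iff: "(\<theta> `` {s}, \<theta> `` {t}) \<in> C n \<longleftrightarrow> (s, t) \<in> D n" if st: "s \<in> T k" "t \<in> T k" for s t n
  proof
    assume "(\<theta> `` {s}, \<theta> `` {t}) \<in> C n"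
    then obtain s' t' where *: "\<theta> `` {s} = \<theta> `` {s'}" "\<theta> `` {t'} = \<theta> `` {t}" "(s', t') \<in> D n"
      unfolding C_def by auto
    then have "s' \<in> T k" using law_congruence_subset[OF D(1)] by blast
    then have "(s, s') \<in> D n" "(t', t) \<in> D n"
      using eq_equiv_class[OF *(1) law_congruence_equiv[OF \<theta>]]
        eq_equiv_class[OF *(2) law_congruence_equiv[OF \<theta>]] st \<theta>D by blast+
    then show "(s, t) \<in> D n" using *(3) law_congruence_trans[OF D(1)] by blast
  qed (auto simp: C_def)
  have C_cases: "\<exists>s t. X = \<theta> `` {s} \<and> Y = \<theta> `` {t} \<and> s \<in> T k \<and> t \<in> T k \<and> (s, t) \<in> D n"
    if "(X, Y) \<in> C n" for X Y n
    using that law_congruence_subset[OF D(1)[of n]] unfolding C_def by blast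
  have "congruence (vsig V) (presented V k {}) (C n)" for n
    unfolding congruence_def carrier_presented \<theta>_def[symmetric]
  proof (intro conjI allI impI)
    show "equiv (T k // \<theta>) (C n)"
    proof (rule equivI)
      show "C n \<subseteq> (T k // \<theta>) \<times> (T k // \<theta>)"
        using law_congruence_subset[OF D(1)[of n]] by (auto simp: C_def intro: quotientI)
      show "refl_on (T k // \<theta>) (C n)"
        by (rule refl_onI) (auto elim!: quotientE simp: D_iff law_congruence_refl[OF D(1)])
      show "sym (C n)"
        by (rule symI) (auto simp: C_def dest: law_congruence_sym[OF D(1)])
      show "trans (C n)"
      proof (rule transI)
        fix X Y Z assume "(X, Y) \<in> C n" "(Y, Z) \<in> C n"
        then obtain s t u v where *: "X = \<theta> `` {s}" "Y = \<theta> `` {t}" "s \<in> T k" "t \<in> T k"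
          "(s, t) \<in> D n" "Z = \<theta> `` {v}" "v \<in> T k" by (meson C_cases)
        then have "(t, v) \<in> D n" using \<open>(Y, Z) \<in> C n\<close> D_iff by blast
        then show "(X, Z) \<in> C n" using * D_iff law_congruence_trans[OF D(1)] by metis
      qed
    qed
  next
    fix f Xs Ys
    assume "f < length (vsig V) \<and> length Xs = vsig V ! f \<and> list_all2 (\<lambda>X Y. (X, Y) \<in> C n) Xs Ys"
    then have f: "f < length (vsig V)" "length Xs = vsig V ! f"
      and XY: "list_all2 (\<lambda>X Y. (X, Y) \<in> C n) Xs Ys" by simp_all
    have "set Xs \<subseteq> T k // \<theta>" "set Ys \<subseteq> T k // \<theta>"
      using XY C_cases by (fastforce simp: list_all2_conv_all_nth in_set_conv_nth intro: quotientI)+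
    then obtain ss ts where ss: "set ss \<subseteq> T k" "Xs = map (\<lambda>a. \<theta> `` {a}) ss"
      and ts: "set ts \<subseteq> T k" "Ys = map (\<lambda>a. \<theta> `` {a}) ts"
      by (metis quotient_list_representatives)
    have len: "length ss = vsig V ! f" "length ts = vsig V ! f"
      using f XY ss(2) ts(2) by (auto dest: list_all2_lengthD)
    have "list_all2 (\<lambda>a b. (a, b) \<in> D n) ss ts"
      using XY ss(1) ts(1) unfolding ss(2) ts(2)
      by (auto simp: list_all2_conv_all_nth D_iff subset_iff)
    then have "(Op f ss, Op f ts) \<in> D n" by (rule law_congruence_Op[OF D(1) f(1) len(1)])
    moreover have "oper (presented V k {}) f Xs = \<theta> `` {Op f ss}"
      unfolding ss(2) \<theta>_def by (rule oper_presented[OF _ f(1) len(1) ss(1)]) simp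
    moreover have "oper (presented V k {}) f Ys = \<theta> `` {Op f ts}"
      unfolding ts(2) \<theta>_def by (rule oper_presented[OF _ f(1) len(2) ts(1)]) simp
    ultimately show "(oper (presented V k {}) f Xs, oper (presented V k {}) f Ys) \<in> C n"
      unfolding C_def by auto
  qed
  moreover have "C n \<subseteq> C (Suc n)" for n
    using D(2)[of n] unfolding C_def by blast
  ultimately obtain N where N: "\<And>n. n \<ge> N \<Longrightarrow> C n = C N"
    using acc unfolding acc_congruences_def by blast
  have "D n = D N" if "n \<ge> N" for n
  proof -
    have "(s, t) \<in> D n \<longleftrightarrow> (s, t) \<in> D N" if "s \<in> T k" "t \<in> T k" for s t
      using N[OF \<open>n \<ge> N\<close>] D_iff[OF that] by metis
    then show ?thesis using law_congruence_subset[OF D(1)[of n]] law_congruence_subset[OF D(1)[of N]] by auto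
  qed
  then show ?thesis using that by blast
qed

lemma decode_rels_subset: "decode_rels (vsig V) k A \<subseteq> trm_pairs (vsig V) k"
  by (auto simp: decode_rels_def)

text \<open>The relations of \<open>A\<close> with codes below \<open>n\<close> generate an
  ascending chain of congruences. Every relation of \<open>A\<close> appears at some stage, so the
  stage from which the chain is constant contains them all.\<close>

lemma finite_subpresentation:
  assumes acc: "Vfg_acc V" and k: "1 \<le> k"
  obtains r where "set_decode r \<subseteq> A \<inter> pair_code (vsig V) k ` trm_pairs (vsig V) k"
    "pres_cong V k (decode_rels (vsig V) k (set_decode r)) = pres_cong V k (decode_rels (vsig V) k A)"
proof -
  define D where "D n = pres_cong V k (decode_rels (vsig V) k (A \<inter> {..<n}))" for n
  have D: "law_congruence k (D n)" for n
    unfolding D_def by (rule law_congruence_pres_cong[OF decode_rels_subset])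
  have mono: "D n \<subseteq> D (Suc n)" for n
    unfolding D_def by (rule pres_cong_mono) (auto simp: decode_rels_def)
  obtain N where N: "\<And>n. n \<ge> N \<Longrightarrow> D n = D N"
    using law_congruence_chain_stabilizes[where D = D, OF acc k D mono] by blast
  have "decode_rels (vsig V) k A \<subseteq> D N"
  proof
    fix p assume p: "p \<in> decode_rels (vsig V) k A"
    define n where "n = max N (Suc (pair_code (vsig V) k p))"
    have "p \<in> decode_rels (vsig V) k (A \<inter> {..<n})"
      using p by (auto simp: decode_rels_def n_def)
    then have "p \<in> D n" using pres_cong_superset[OF decode_rels_subset] unfolding D_def by blast
    then show "p \<in> D N" using N[of n] by (simp add: n_def)
  qed
  then have "pres_cong V k (decode_rels (vsig V) k A) \<subseteq> D N"
    by (rule pres_cong_least[OF D])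
  moreover have "D N \<subseteq> pres_cong V k (decode_rels (vsig V) k A)"
    unfolding D_def by (rule pres_cong_mono) (auto simp: decode_rels_def)
  ultimately have DN: "D N = pres_cong V k (decode_rels (vsig V) k A)" by blast
  \<comment> \<open>Restricting to codes of pairs does not change the decoded relations and gives
    the required inclusion.\<close>
  define B where "B = A \<inter> {..<N} \<inter> pair_code (vsig V) k ` trm_pairs (vsig V) k"
  have "finite B" by (simp add: B_def)
  then have B: "set_decode (set_encode B) = B" by simp
  moreover have "decode_rels (vsig V) k B = decode_rels (vsig V) k (A \<inter> {..<N})"
    by (auto simp: decode_rels_def B_def)
  ultimately show ?thesis
    using that[of "set_encode B"] DN by (auto simp: D_def B_def)
qed

text \<open>
  The chain \<open>C\<close> consists of the kernels of the iterates of the surjective endomorphism induced by the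
  isomorphism \<open>\<tau>\<close>; it stabilizes, and surjectivity propagates this down to \<open>C 1 = C 0\<close>.
\<close>

lemma hopfian:
  assumes acc: "Vfg_acc V" and k: "1 \<le> k"
    and RR': "R \<subseteq> R'" and R': "R' \<subseteq> trm_pairs (vsig V) k"
    and iso: "isomorphic (vsig V) (presented V k R) (presented V k R')"
  shows "pres_cong V k R' = pres_cong V k R"
proof -
  have R: "R \<subseteq> trm_pairs (vsig V) k" using RR' R' by blast
  obtain \<sigma> \<tau> where inv: "presentations_inverse k R k R' \<sigma> \<tau>"
    using isomorphic_imp_presentations_inverse[OF iso R R'] by blast
  then have \<tau>: "pres_hom k R' k R \<tau>" and \<sigma>T: "\<And>i. i < k \<Longrightarrow> \<sigma> i \<in> T k" and \<tau>T: "\<And>i. i < k \<Longrightarrow> \<tau> i \<in> T k"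
    by (auto simp: presentations_inverse_def pres_hom_def)
  \<comment> \<open>\<open>pull\<close> takes preimages under \<open>\<tau>\<close>. Iterated on the
    congruence of \<open>R\<close>, it yields the kernels of the iterates of \<open>\<tau>\<close>
    as maps into the algebra presented by \<open>R\<close>.\<close>
  define pull where "pull \<phi> = {(s, t). s \<in> T k \<and> t \<in> T k \<and> (subst \<tau> s, subst \<tau> t) \<in> \<phi>}" for \<phi>
  define C where "C n = (pull ^^ n) (pres_cong V k R)" for n
  have C_Suc: "C (Suc n) = pull (C n)" for n by (simp add: C_def)
  have C_cong: "law_congruence k (C n)" for n
  proof (induction n)
    case 0
    show ?case using law_congruence_pres_cong[OF R] by (simp add: C_def)
  next
    case (Suc n)
    then show ?case unfolding C_Suc pull_def by (rule pullback_law_congruence[OF _ \<tau>T])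
  qed
  \<comment> \<open>\<open>\<tau>\<close> is a homomorphism from the presentation by
    \<open>R'\<close> to the one by \<open>R\<close>, so it turns every equality under
    \<open>R'\<close> into one under \<open>R\<close>.\<close>
  have sub: "pres_cong V k R' \<subseteq> C 1"
  proof (rule subrelI)
    fix s t assume st: "(s, t) \<in> pres_cong V k R'"
    then have "s \<in> T k" "t \<in> T k"
      using law_congruence_subset[OF law_congruence_pres_cong[OF R']] by blast+
    then show "(s, t) \<in> C 1"
      using pres_hom_subst[OF \<tau> R' R st] by (simp add: C_def pull_def)
  qed
  have C_mono: "C n \<subseteq> C (Suc n)" for n
  proof (induction n)
    case 0
    show ?case using sub pres_cong_mono[OF RR', of k] by (auto simp: C_def)
  next
    case (Suc n)
    then show ?case unfolding C_Suc pull_def by blast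
  qed
  obtain N where N: "\<And>n. n \<ge> N \<Longrightarrow> C n = C N"
    using law_congruence_chain_stabilizes[where D = C, OF acc k C_cong C_mono] by blast
  have down: "C (Suc n) \<subseteq> C n" if "C (Suc (Suc n)) \<subseteq> C (Suc n)" for n
  proof (rule subrelI)
    fix s t assume st: "(s, t) \<in> C (Suc n)"
    then have T: "s \<in> T k" "t \<in> T k" using law_congruence_subset[OF C_cong] by blast+
    have zero: "pres_cong V k R \<subseteq> C m" for m
      by (induction m) (use C_mono in \<open>auto simp: C_def\<close>)
    \<comment> \<open>Surjectivity in concrete form: modulo each \<open>C m\<close>, the term
      \<open>subst \<sigma> u\<close> is mapped by \<open>\<tau>\<close> to
      \<open>u\<close>.\<close>
    have retract: "(subst \<tau> (subst \<sigma> u), u) \<in> C m" if "u \<in> T k" for u m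
      using zero presentations_inverse_subst[OF inv R that] by blast
    \<comment> \<open>Passing to the preimages \<open>subst \<sigma> s\<close> and
      \<open>subst \<sigma> t\<close> raises the stage by one. The assumed inclusion lowers it by
      one there, and applying \<open>\<tau>\<close> lowers it once more.\<close>
    have "(subst \<tau> (subst \<sigma> s), subst \<tau> (subst \<sigma> t)) \<in> C (Suc n)"
      using st retract[OF T(1)] law_congruence_sym[OF C_cong retract[OF T(2)]]
        law_congruence_trans[OF C_cong] by blast
    then have "(subst \<sigma> s, subst \<sigma> t) \<in> C (Suc (Suc n))"
      unfolding C_Suc[of "Suc n"] pull_def using T \<sigma>T by (auto intro: subst_in_trms)
    then have "(subst \<tau> (subst \<sigma> s), subst \<tau> (subst \<sigma> t)) \<in> C n"
      using that unfolding C_Suc[of n] pull_def by blast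
    then show "(s, t) \<in> C n"
      using retract[OF T(2)] law_congruence_sym[OF C_cong retract[OF T(1)]]
        law_congruence_trans[OF C_cong] by blast
  qed
  have "C (Suc 0) \<subseteq> C 0"
  proof (rule inc_induct[of 0 N "\<lambda>n. C (Suc n) \<subseteq> C n"])
    show "C (Suc N) \<subseteq> C N" using N[of "Suc N"] by simp
  qed (use down in auto)
  then show ?thesis using sub pres_cong_mono[OF RR', of k] by (auto simp: C_def)
qed

end

section \<open>Codes of terms\<close>

lemma trm_code_Var: "trm_code (Var i) = 2 * i"
  and trm_code_Op: "trm_code (Op f ts) = Suc (2 * prod_encode (f, list_encode (map trm_code ts)))"
  by (simp_all add: sum_encode_def)

declare trm_code.simps [simp del] trm_code_Var [simp]

definition term_code :: "signature \<Rightarrow> nat \<Rightarrow> nat \<Rightarrow> bool" where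
  "term_code sig k n \<longleftrightarrow> n \<in> trm_code ` trms sig {..<k}"

lemma list_code_cases:
  obtains xs where "L = list_encode xs"
  by (metis list_decode_inverse)

lemma nth_code_less: "i < length_code L \<Longrightarrow> nth_code L i < L"
  by (cases L rule: list_code_cases)
    (simp add: length_code_list_encode nth_code_list_encode nth_less_list_encode)

text \<open>The finite signature enters as a constant list code, so arities are looked up
  computably. Variables have even codes and compound terms odd ones.\<close>

definition term_code_step :: "signature \<Rightarrow> nat \<Rightarrow> nat \<Rightarrow> nat set \<Rightarrow> bool" where
  "term_code_step sig k n T \<longleftrightarrow> (\<exists>i<k. n = 2 * i) \<or>
     (\<exists>f<length sig. \<exists>L<n. n = Suc (2 * prod_encode (f, L)) \<and>
        length_code L = nth_code (list_encode sig) f \<and> (\<forall>i<length_code L. nth_code L i \<in> T))"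

lemma term_code_rec: "term_code sig k n \<longleftrightarrow> term_code_step sig k n {m. m < n \<and> term_code sig k m}"
proof
  assume "term_code sig k n"
  then obtain t where t: "n = trm_code t" "t \<in> trms sig {..<k}" by (auto simp: term_code_def)
  from t(2) show "term_code_step sig k n {m. m < n \<and> term_code sig k m}"
  proof cases
    case (1 i)
    then show ?thesis using t(1) by (auto simp: term_code_step_def)
  next
    case (2 f ts)
    define L where "L = list_encode (map trm_code ts)"
    have n: "n = Suc (2 * prod_encode (f, L))" using t(1) 2(1) trm_code_Op by (simp only: L_def)
    have L: "L < n" using le_prod_encode_2[of L f] by (simp add: n)
    have "nth_code L i \<in> {m. m < n \<and> term_code sig k m}" if "i < length_code L" for i
    proof -
      have "i < length ts" using that by (simp add: L_def length_code_list_encode)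
      then have "term_code sig k (nth_code L i)"
        using 2(4) by (simp add: L_def nth_code_list_encode term_code_def)
      then show ?thesis using nth_code_less[OF that] L by simp
    qed
    moreover have "length_code L = nth_code (list_encode sig) f"
      using 2 by (simp add: L_def length_code_list_encode nth_code_list_encode)
    ultimately show ?thesis unfolding term_code_step_def using n L 2(2) by blast
  qed
next
  assume "term_code_step sig k n {m. m < n \<and> term_code sig k m}"
  then consider i where "i < k" "n = 2 * i"
    | f L where "f < length sig" "n = Suc (2 * prod_encode (f, L))"
      "length_code L = nth_code (list_encode sig) f" "\<And>i. i < length_code L \<Longrightarrow> term_code sig k (nth_code L i)"
    unfolding term_code_step_def by blast
  then show "term_code sig k n"
  proof cases
    case (1 i)
    then have "Var i \<in> trms sig {..<k}" by (auto intro: trms.intros)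
    then show ?thesis unfolding term_code_def 1(2) trm_code_Var[symmetric] by (rule imageI)
  next
    case (2 f L)
    obtain xs where L: "L = list_encode xs" by (rule list_code_cases)
    have "xs ! i \<in> trm_code ` trms sig {..<k}" if "i < length xs" for i
      using 2(4)[of i] that by (simp add: L length_code_list_encode nth_code_list_encode term_code_def)
    then have "set xs \<subseteq> trm_code ` trms sig {..<k}" by (auto simp: in_set_conv_nth)
    then have "xs \<in> map trm_code ` lists (trms sig {..<k})"
      unfolding lists_image[symmetric] by auto
    then obtain ts where ts: "set ts \<subseteq> trms sig {..<k}" "xs = map trm_code ts" by auto
    then have "Op f ts \<in> trms sig {..<k}"
      using 2(1,3) by (auto intro!: trms.intros simp: L length_code_list_encode nth_code_list_encode)
    moreover have "n = trm_code (Op f ts)" unfolding 2(2) L ts(2) by (rule trm_code_Op[symmetric])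
    ultimately show ?thesis unfolding term_code_def by (rule rev_image_eqI)
  qed
qed

text \<open>Strong induction shows that the recursion through \<open>term_code_step\<close> has only
  one solution, so the decidable predicate obtained from it is \<open>term_code\<close>.\<close>

lemma dec_term_code [comp_intros]:
  assumes "computable f" "computable g"
  shows "dec (\<lambda>z. term_code sig (f z) (g z))"
proof (rule dec2[OF _ assms])
  have "dec (\<lambda>w. term_code_step sig (pfst w) (pfst (psnd w)) (set_decode (psnd (psnd w))))"
    unfolding term_code_step_def by (intro comp_intros)
  then obtain P where P: "dec (\<lambda>w. P (pfst w) (psnd w))"
    "\<And>k n. P k n \<longleftrightarrow> term_code_step sig k n {m. m < n \<and> P k m}"
    using dec_course_of_values[of "term_code_step sig"] by blast
  have "P k n \<longleftrightarrow> term_code sig k n" for k n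
  proof (induction n rule: less_induct)
    case (less n)
    then have "{m. m < n \<and> P k m} = {m. m < n \<and> term_code sig k m}" by blast
    then show ?case using P(2)[of k n] term_code_rec[of sig k n] by (simp only:)
  qed
  then show "dec (\<lambda>w. term_code sig (pfst w) (psnd w))" using P(1) by simp
qed

text \<open>The counterpart of \<open>pair_code\<close> on codes of terms. Counting Goedel numbers
  instead of pairs of terms makes it a bounded count of a decidable predicate.\<close>

definition pair_index :: "signature \<Rightarrow> nat \<Rightarrow> nat \<Rightarrow> nat \<Rightarrow> nat" where
  "pair_index sig k a b =
     card {m. m < prod_encode (a, b) \<and> term_code sig k (pfst m) \<and> term_code sig k (psnd m)}"

lemma computable_pair_index [comp_intros]:
  assumes "computable k" "computable a" "computable b"
  shows "computable (\<lambda>z. pair_index sig (k z) (a z) (b z))"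
  unfolding pair_index_def by (intro comp_intros assms computable_comp[OF assms(1)])

lemma pair_index_trm_code: "pair_index sig k (trm_code s) (trm_code t) = pair_code sig k (s, t)"
proof -
  have "goedel ` {q \<in> trm_pairs sig k. goedel q < goedel (s, t)} =
      {m. m < prod_encode (trm_code s, trm_code t) \<and> term_code sig k (pfst m) \<and> term_code sig k (psnd m)}"
    (is "?A = ?B")
  proof
    show "?A \<subseteq> ?B" by (auto simp: goedel_def trm_pairs_def term_code_def)
    show "?B \<subseteq> ?A"
    proof
      fix m assume m: "m \<in> ?B"
      then obtain u v where uv: "u \<in> trms sig {..<k}" "v \<in> trms sig {..<k}"
        "pfst m = trm_code u" "psnd m = trm_code v" by (auto simp: term_code_def)
      then have "goedel (u, v) = prod_encode (pfst m, psnd m)" by (simp only: goedel_def prod.case)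
      then have "m = goedel (u, v)" by simp
      then show "m \<in> ?A" using m uv by (auto simp: trm_pairs_def goedel_def)
    qed
  qed
  then show ?thesis
    using card_image[OF inj_on_subset[OF inj_goedel subset_UNIV],
        of "{q \<in> trm_pairs sig k. goedel q < goedel (s, t)}"]
    by (simp only: pair_index_def pair_code_def)
qed

text \<open>The rank increases strictly with the Goedel number. This also covers finitely many
  pairs, as for a signature of constants only, where the coding is not onto.\<close>

lemma inj_on_pair_code: "inj_on (pair_code sig k) (trm_pairs sig k)"
proof (rule inj_onI)
  have less: "pair_code sig k p < pair_code sig k q" if "p \<in> trm_pairs sig k" "goedel p < goedel q" for p q
    unfolding pair_code_def
  proof (rule psubset_card_mono)
    have "goedel ` {r \<in> trm_pairs sig k. goedel r < goedel q} \<subseteq> {..<goedel q}" by auto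
    then show "finite {r \<in> trm_pairs sig k. goedel r < goedel q}"
      by (rule inj_on_finite[OF inj_on_subset[OF inj_goedel subset_UNIV]]) simp
  qed (use that in auto)
  fix p q assume "p \<in> trm_pairs sig k" "q \<in> trm_pairs sig k" "pair_code sig k p = pair_code sig k q"
  then have "goedel p = goedel q"
    using less[of p q] less[of q p] by (cases "goedel p" "goedel q" rule: linorder_cases) auto
  then show "p = q" using inj_goedel by (simp add: inj_eq)
qed

text \<open>Images of variables are arbitrary numbers, so a list code can act as a substitution
  through \<open>nth_code\<close> before its entries are known to code terms.\<close>

primrec subst_code :: "(nat \<Rightarrow> nat) \<Rightarrow> trm \<Rightarrow> nat" where
  "subst_code \<tau> (Var i) = \<tau> i"
| "subst_code \<tau> (Op f ts) = Suc (2 * prod_encode (f, list_encode (map (subst_code \<tau>) ts)))"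

lemma subst_code_eq:
  assumes "t \<in> trms sig {..<k}" "\<And>i. i < k \<Longrightarrow> \<tau> i = trm_code (\<sigma> i)"
  shows "subst_code \<tau> t = trm_code (subst \<sigma> t)"
  using assms(1)
proof induction
  case (2 f ts)
  then have "map (subst_code \<tau>) ts = map trm_code (map (subst \<sigma>) ts)" by simp
  then show ?case by (simp only: subst.simps subst_code.simps trm_code_Op)
qed (simp add: assms(2))

text \<open>The graph of substitution takes the place of a function because the available
  course-of-values recursion produces predicates.\<close>

definition subst_rel :: "nat \<Rightarrow> nat \<Rightarrow> bool" where
  "subst_rel F n \<longleftrightarrow> (\<exists>t. pfst n = trm_code t \<and> psnd n = subst_code (nth_code F) t)"

text \<open>Input and output argument lists are compared entry by entry through codes of pairs. The
  bound \<open>Suc (pfst n)\<close> admits the variable 0, whose code is 0.\<close>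

definition subst_step :: "nat \<Rightarrow> nat \<Rightarrow> nat set \<Rightarrow> bool" where
  "subst_step F n T \<longleftrightarrow> (\<exists>i<Suc (pfst n). pfst n = 2 * i \<and> psnd n = nth_code F i) \<or>
     (\<exists>f<pfst n. \<exists>L<pfst n. \<exists>M<psnd n. pfst n = Suc (2 * prod_encode (f, L)) \<and>
        psnd n = Suc (2 * prod_encode (f, M)) \<and> length_code L = length_code M \<and>
        (\<forall>i<length_code L. prod_encode (nth_code L i, nth_code M i) \<in> T))"

text \<open>Both components shrink when passing from a compound term and its image to an argument
  and its image; this puts the corresponding pair code below the original one.\<close>

lemma prod_encode_less_mono:
  assumes "a < c" "b < d"
  shows "prod_encode (a, b) < prod_encode (c, d)"
proof -
  have "triangle (a + b) \<le> triangle (c + d)"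
    unfolding triangle_def using assms by (intro div_le_mono mult_le_mono) auto
  then show ?thesis using assms by (simp add: prod_encode_def)
qed

lemma subst_rel_rec: "subst_rel F n \<longleftrightarrow> subst_step F n {m. m < n \<and> subst_rel F m}"
proof
  assume "subst_rel F n"
  then obtain t where t: "pfst n = trm_code t" "psnd n = subst_code (nth_code F) t"
    by (auto simp: subst_rel_def)
  show "subst_step F n {m. m < n \<and> subst_rel F m}"
  proof (cases t)
    case (Var i)
    then show ?thesis using t by (auto simp: subst_step_def)
  next
    case (Op f ts)
    define L where "L = list_encode (map trm_code ts)"
    define M where "M = list_encode (map (subst_code (nth_code F)) ts)"
    have n: "pfst n = Suc (2 * prod_encode (f, L))" "psnd n = Suc (2 * prod_encode (f, M))"
      using t Op trm_code_Op by (simp_all only: L_def M_def subst_code.simps)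
    have less: "f < pfst n" "L < pfst n" "M < psnd n"
      using le_prod_encode_1[of f L] le_prod_encode_2[of L f] le_prod_encode_2[of M f] n by linarith+
    have len: "length_code L = length ts" "length_code M = length ts"
      by (simp_all add: L_def M_def length_code_list_encode)
    have len_eq: "length_code L = length_code M" using len by simp
    have elem: "prod_encode (nth_code L i, nth_code M i) \<in> {m. m < n \<and> subst_rel F m}"
      if "i < length_code L" for i
    proof -
      have i: "i < length ts" using that len by simp
      have "nth_code L i < pfst n" "nth_code M i < psnd n"
        using nth_code_less[of i L] nth_code_less[of i M] less that len by auto
      then have "prod_encode (nth_code L i, nth_code M i) < n"
        using prod_encode_less_mono prod_encode_pfst_psnd by metis
      moreover have "nth_code L i = trm_code (ts ! i)" "nth_code M i = subst_code (nth_code F) (ts ! i)"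
        using i by (simp_all add: L_def M_def nth_code_list_encode)
      ultimately show ?thesis by (auto simp: subst_rel_def)
    qed
    show ?thesis unfolding subst_step_def
      by (intro disjI2 exI[of _ f] exI[of _ L] exI[of _ M] conjI allI impI)
        (fact less n len_eq | erule elem)+
  qed
next
  assume "subst_step F n {m. m < n \<and> subst_rel F m}"
  then consider i where "pfst n = 2 * i" "psnd n = nth_code F i"
    | f L M where "pfst n = Suc (2 * prod_encode (f, L))" "psnd n = Suc (2 * prod_encode (f, M))"
      "length_code L = length_code M"
      "\<And>i. i < length_code L \<Longrightarrow> subst_rel F (prod_encode (nth_code L i, nth_code M i))"
    unfolding subst_step_def by blast
  then show "subst_rel F n"
  proof cases
    case (1 i)
    then have "pfst n = trm_code (Var i) \<and> psnd n = subst_code (nth_code F) (Var i)"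
      by simp
    then show ?thesis unfolding subst_rel_def by blast
  next
    case (2 f L M)
    obtain xs ys where LM: "L = list_encode xs" "M = list_encode ys" using list_code_cases by metis
    have len: "length xs = length ys" using 2(3) by (simp add: LM length_code_list_encode)
    have "\<exists>t. xs ! i = trm_code t \<and> ys ! i = subst_code (nth_code F) t" if "i < length xs" for i
      using 2(4)[of i] that len
      by (simp add: LM length_code_list_encode nth_code_list_encode subst_rel_def)
    then obtain t where t: "\<And>i. i < length xs \<Longrightarrow> xs ! i = trm_code (t i)"
      "\<And>i. i < length xs \<Longrightarrow> ys ! i = subst_code (nth_code F) (t i)" by metis
    define ts where "ts = map t [0..<length xs]"
    have "xs = map trm_code ts" "ys = map (subst_code (nth_code F)) ts"
      using len t by (auto simp: ts_def intro!: nth_equalityI)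
    then have "pfst n = trm_code (Op f ts) \<and> psnd n = subst_code (nth_code F) (Op f ts)"
      using 2(1,2) LM by (simp only: trm_code_Op subst_code.simps)
    then show ?thesis unfolding subst_rel_def by blast
  qed
qed

lemma dec_subst_rel [comp_intros]:
  assumes "computable f" "computable g"
  shows "dec (\<lambda>z. subst_rel (f z) (g z))"
proof (rule dec2[OF _ assms])
  have "dec (\<lambda>w. subst_step (pfst w) (pfst (psnd w)) (set_decode (psnd (psnd w))))"
    unfolding subst_step_def by (intro comp_intros)
  then obtain P where P: "dec (\<lambda>w. P (pfst w) (psnd w))"
    "\<And>F n. P F n \<longleftrightarrow> subst_step F n {m. m < n \<and> P F m}"
    using dec_course_of_values[of "subst_step"] by blast
  have "P F n \<longleftrightarrow> subst_rel F n" for F n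
  proof (induction n rule: less_induct)
    case (less n)
    then have "{m. m < n \<and> P F m} = {m. m < n \<and> subst_rel F m}" by blast
    then show ?case using P(2)[of F n] subst_rel_rec[of F n] by (simp only:)
  qed
  then show "dec (\<lambda>w. subst_rel (pfst w) (psnd w))" using P(1) by simp
qed

lemma subst_rel_trm_code:
  assumes "t \<in> trms sig {..<k}" "\<And>i. i < k \<Longrightarrow> nth_code F i = trm_code (\<sigma> i)"
  shows "subst_rel F (prod_encode (trm_code t, b)) \<longleftrightarrow> b = trm_code (subst \<sigma> t)"
  using subst_code_eq[of t sig k "nth_code F" \<sigma>, OF assms]
  by (auto simp: subst_rel_def dest: trm_code_inj)

section \<open>The isomorphism relation from a decidable word problem\<close>

text \<open>\<open>E k r a b\<close> decides, on codes of terms, equality in the algebra presented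
  by \<open>r\<close>. Its value on numbers that code no terms over \<open>k\<close> variables is
  left open, so the conditions below that query \<open>E\<close> also ensure that its arguments are
  term codes.\<close>

locale acc_word_problem = well_formed_variety +
  fixes E :: "nat \<Rightarrow> nat \<Rightarrow> nat \<Rightarrow> nat \<Rightarrow> bool"
  assumes acc: "Vfg_acc V"
    and dec_E: "dec (\<lambda>w. E (pfst w) (pfst (psnd w)) (pfst (psnd (psnd w))) (psnd (psnd (psnd w))))"
    and E_iff: "\<And>k r s t. 1 \<le> k \<Longrightarrow> s \<in> T k \<Longrightarrow> t \<in> T k \<Longrightarrow> E k r (trm_code s) (trm_code t) \<longleftrightarrow>
      (s, t) \<in> pres_cong V k (decode_rels (vsig V) k (set_decode r))"
begin

abbreviation rels :: "nat \<Rightarrow> nat \<Rightarrow> (trm \<times> trm) set" where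
  "rels k r \<equiv> decode_rels (vsig V) k (set_decode r)"

abbreviation code_pair :: "nat \<Rightarrow> nat \<Rightarrow> nat \<Rightarrow> nat \<Rightarrow> bool" where
  "code_pair k a b c \<equiv>
     term_code (vsig V) k a \<and> term_code (vsig V) k b \<and> pair_index (vsig V) k a b = c"

lemma dec_E_comp [comp_intros]:
  assumes "computable k" "computable r" "computable a" "computable b"
  shows "dec (\<lambda>z. E (k z) (r z) (a z) (b z))"
  using dec_comp[OF dec_E, of "\<lambda>z. prod_encode (k z, prod_encode (r z, prod_encode (a z, b z)))"]
    assms by (simp add: computable_prod_encode)

lemma code_pair_iff:
  "code_pair k a b c \<longleftrightarrow> (\<exists>s t. s \<in> T k \<and> t \<in> T k \<and> a = trm_code s \<and> b = trm_code t \<and>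
     pair_code (vsig V) k (s, t) = c)"
  unfolding term_code_def image_iff using pair_index_trm_code by metis

text \<open>On codes, \<open>F\<close> is a homomorphism and \<open>G\<close> after \<open>F\<close>
  fixes the generators; two symmetric copies make an isomorphism. All elements of
  \<open>set_decode r\<close> lie below \<open>r\<close>, hence the bound on \<open>c\<close>, and
  \<open>2 * i\<close> is the code of \<open>Var i\<close>.\<close>

definition half_inverse :: "nat \<Rightarrow> nat \<Rightarrow> nat \<Rightarrow> nat \<Rightarrow> nat \<Rightarrow> nat \<Rightarrow> bool" where
  "half_inverse k r j s F G \<longleftrightarrow>
     (\<forall>i<k. term_code (vsig V) j (nth_code F i)) \<and>
     (\<forall>c<r. c \<in> set_decode r \<longrightarrow> (\<exists>a b a' b'. code_pair k a b c \<and>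
        subst_rel F (prod_encode (a, a')) \<and> subst_rel F (prod_encode (b, b')) \<and>
        term_code (vsig V) j a' \<and> term_code (vsig V) j b' \<and> E j s a' b')) \<and>
     (\<forall>i<k. \<exists>a. term_code (vsig V) k a \<and> subst_rel G (prod_encode (nth_code F i, a)) \<and> E k r a (2 * i))"

lemma semidec_half_inverse [semidec_intros]:
  assumes "computable k" "computable r" "computable j" "computable s" "computable F" "computable G"
  shows "semidec (\<lambda>z. half_inverse (k z) (r z) (j z) (s z) (F z) (G z))"
  unfolding half_inverse_def
  by (intro semidec_intros; (rule semidec_dec)?; intro comp_intros assms computable_comp[OF assms(1)]
      computable_comp[OF assms(2)] computable_comp[OF assms(3)] computable_comp[OF assms(4)]
      computable_comp[OF assms(5)] computable_comp[OF assms(6)])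

lemma half_inverse_iff:
  assumes k: "1 \<le> k" "1 \<le> j"
    and r: "set_decode r \<subseteq> pair_code (vsig V) k ` trm_pairs (vsig V) k"
    and \<sigma>: "\<And>i. i < k \<Longrightarrow> \<sigma> i \<in> T j" "\<And>i. i < k \<Longrightarrow> nth_code F i = trm_code (\<sigma> i)"
    and \<tau>: "\<And>i. i < j \<Longrightarrow> \<tau> i \<in> T k" "\<And>i. i < j \<Longrightarrow> nth_code G i = trm_code (\<tau> i)"
  shows "half_inverse k r j s F G \<longleftrightarrow> pres_hom k (rels k r) j (rels j s) \<sigma> \<and>
    (\<forall>i<k. (subst \<tau> (\<sigma> i), Var i) \<in> pres_cong V k (rels k r))"
proof -
  have \<sigma>_T: "subst \<sigma> u \<in> T j" if "u \<in> T k" for u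
    using that \<sigma>(1) by (auto intro: subst_in_trms)
  have \<tau>_T: "subst \<tau> u \<in> T k" if "u \<in> T j" for u
    using that \<tau>(1) by (auto intro: subst_in_trms)
  note \<sigma>_rel = subst_rel_trm_code[where sig = "vsig V" and F = F and \<sigma> = \<sigma>, OF _ \<sigma>(2)]
  note \<tau>_rel = subst_rel_trm_code[where sig = "vsig V" and F = G and \<sigma> = \<tau>, OF _ \<tau>(2)]
  have code_T: "term_code (vsig V) m (trm_code t)" if "t \<in> T m" for m t
    using that by (simp add: term_code_def)
  define P where "P c \<longleftrightarrow> (\<exists>a b a' b'. code_pair k a b c \<and>
        subst_rel F (prod_encode (a, a')) \<and> subst_rel F (prod_encode (b, b')) \<and>
        term_code (vsig V) j a' \<and> term_code (vsig V) j b' \<and> E j s a' b')" for c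
  have rel: "P (pair_code (vsig V) k (u, v)) \<longleftrightarrow> (subst \<sigma> u, subst \<sigma> v) \<in> pres_cong V j (rels j s)"
    (is "_ \<longleftrightarrow> ?R")
    if uv: "u \<in> T k" "v \<in> T k" for u v
  proof
    assume "P (pair_code (vsig V) k (u, v))"
    then obtain a b a' b' where *: "code_pair k a b (pair_code (vsig V) k (u, v))"
      "subst_rel F (prod_encode (a, a'))" "subst_rel F (prod_encode (b, b'))" "E j s a' b'" unfolding P_def by blast
    then obtain u' v' where uv': "u' \<in> T k" "v' \<in> T k" "a = trm_code u'" "b = trm_code v'"
      "pair_code (vsig V) k (u', v') = pair_code (vsig V) k (u, v)"
      unfolding code_pair_iff by blast
    \<comment> \<open>The search for a pair with a given code can only return the intended one, by
      injectivity of \<open>pair_code\<close>.\<close>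
    then have "u' = u" "v' = v"
      using inj_onD[OF inj_on_pair_code uv'(5)] uv by (auto simp: trm_pairs_def)
    then have "a' = trm_code (subst \<sigma> u)" "b' = trm_code (subst \<sigma> v)"
      using *(2,3) uv'(3,4) \<sigma>_rel uv by simp_all
    then show ?R using *(4) E_iff[OF k(2) \<sigma>_T[OF uv(1)] \<sigma>_T[OF uv(2)]] by simp
  next
    assume ?R
    then have "E j s (trm_code (subst \<sigma> u)) (trm_code (subst \<sigma> v))"
      using E_iff[OF k(2) \<sigma>_T[OF uv(1)] \<sigma>_T[OF uv(2)]] by simp
    moreover have "code_pair k (trm_code u) (trm_code v) (pair_code (vsig V) k (u, v))"
      unfolding code_pair_iff using uv by blast
    ultimately show "P (pair_code (vsig V) k (u, v))"
      unfolding P_def using \<sigma>_rel uv code_T[OF \<sigma>_T] by blast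
  qed
  have "(\<forall>c<r. c \<in> set_decode r \<longrightarrow> P c) \<longleftrightarrow>
      (\<forall>(u, v)\<in>rels k r. (subst \<sigma> u, subst \<sigma> v) \<in> pres_cong V j (rels j s))"
  proof -
    have "(\<forall>c<r. c \<in> set_decode r \<longrightarrow> P c) \<longleftrightarrow> (\<forall>c\<in>set_decode r. P c)"
      using in_set_decode_less by blast
    also have "\<dots> \<longleftrightarrow> (\<forall>p\<in>rels k r. P (pair_code (vsig V) k p))"
      using r by (auto simp: decode_rels_def)
    also have "\<dots> \<longleftrightarrow> (\<forall>(u, v)\<in>rels k r. (subst \<sigma> u, subst \<sigma> v) \<in> pres_cong V j (rels j s))"
    proof (rule ball_cong[OF refl])
      fix p assume "p \<in> rels k r"
      then obtain u v where "p = (u, v)" "u \<in> T k" "v \<in> T k"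
        by (auto simp: decode_rels_def trm_pairs_def)
      then show "P (pair_code (vsig V) k p) \<longleftrightarrow>
          (case p of (u, v) \<Rightarrow> (subst \<sigma> u, subst \<sigma> v) \<in> pres_cong V j (rels j s))"
        using rel by simp
    qed
    finally show ?thesis .
  qed
  moreover have "(\<exists>a. term_code (vsig V) k a \<and> subst_rel G (prod_encode (nth_code F i, a)) \<and> E k r a (2 * i))
      \<longleftrightarrow> (subst \<tau> (\<sigma> i), Var i) \<in> pres_cong V k (rels k r)" if i: "i < k" for i
  proof -
    have "Var i \<in> T k" using i by (auto intro: trms.intros)
    then show ?thesis
      using E_iff[OF k(1) \<tau>_T[OF \<sigma>(1)[OF i]], of "Var i" r] \<tau>_rel[OF \<sigma>(1)[OF i]] \<sigma>(2)[OF i]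
        code_T[OF \<tau>_T[OF \<sigma>(1)[OF i]]] by auto
  qed
  moreover have "\<forall>i<k. term_code (vsig V) j (nth_code F i)" using \<sigma> code_T by simp
  ultimately show ?thesis
    unfolding half_inverse_def P_def[symmetric] pres_hom_def using \<sigma>(1) by blast
qed

lemma isomorphic_iff_half_inverse:
  assumes k: "1 \<le> k" "1 \<le> j"
    and r: "set_decode r \<subseteq> pair_code (vsig V) k ` trm_pairs (vsig V) k"
    and s: "set_decode s \<subseteq> pair_code (vsig V) j ` trm_pairs (vsig V) j"
  shows "isomorphic (vsig V) (presented V k (rels k r)) (presented V j (rels j s)) \<longleftrightarrow>
    (\<exists>F G. half_inverse k r j s F G \<and> half_inverse j s k r G F)"
proof
  assume "isomorphic (vsig V) (presented V k (rels k r)) (presented V j (rels j s))"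
  then obtain \<sigma> \<tau> where inv: "presentations_inverse k (rels k r) j (rels j s) \<sigma> \<tau>"
    by (rule isomorphic_imp_presentations_inverse) (rule decode_rels_subset)+
  define F where "F = list_encode (map (\<lambda>i. trm_code (\<sigma> i)) [0..<k])"
  define G where "G = list_encode (map (\<lambda>i. trm_code (\<tau> i)) [0..<j])"
  have \<sigma>: "\<sigma> i \<in> T j" "nth_code F i = trm_code (\<sigma> i)" if "i < k" for i
    using inv that by (auto simp: presentations_inverse_def pres_hom_def F_def nth_code_list_encode)
  have \<tau>: "\<tau> i \<in> T k" "nth_code G i = trm_code (\<tau> i)" if "i < j" for i
    using inv that by (auto simp: presentations_inverse_def pres_hom_def G_def nth_code_list_encode)
  have "half_inverse k r j s F G \<and> half_inverse j s k r G F"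
    using half_inverse_iff[OF k r \<sigma> \<tau>] half_inverse_iff[OF k(2,1) s \<tau> \<sigma>] inv
    unfolding presentations_inverse_def by blast
  then show "\<exists>F G. half_inverse k r j s F G \<and> half_inverse j s k r G F" by blast
next
  assume "\<exists>F G. half_inverse k r j s F G \<and> half_inverse j s k r G F"
  then obtain F G where FG: "half_inverse k r j s F G" "half_inverse j s k r G F" by blast
  \<comment> \<open>The first conjunct of \<open>half_inverse\<close> guarantees that the relevant
    entries of \<open>F\<close> and \<open>G\<close> code terms, so actual substitutions can be
    extracted.\<close>
  then have "\<forall>i<k. \<exists>t. t \<in> T j \<and> nth_code F i = trm_code t" "\<forall>i<j. \<exists>t. t \<in> T k \<and> nth_code G i = trm_code t"
    unfolding half_inverse_def term_code_def by blast+
  then obtain \<sigma> \<tau> where \<sigma>: "\<And>i. i < k \<Longrightarrow> \<sigma> i \<in> T j" "\<And>i. i < k \<Longrightarrow> nth_code F i = trm_code (\<sigma> i)"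
    and \<tau>: "\<And>i. i < j \<Longrightarrow> \<tau> i \<in> T k" "\<And>i. i < j \<Longrightarrow> nth_code G i = trm_code (\<tau> i)" by metis
  have "presentations_inverse k (rels k r) j (rels j s) \<sigma> \<tau>"
    using half_inverse_iff[OF k r \<sigma> \<tau>] half_inverse_iff[OF k(2,1) s \<tau> \<sigma>] FG
    unfolding presentations_inverse_def by blast
  then show "isomorphic (vsig V) (presented V k (rels k r)) (presented V j (rels j s))"
    by (rule presentations_inverse_imp_isomorphic) (rule decode_rels_subset)+
qed

text \<open>
  \<^const>\<open>decode_rels\<close> ignores numbers that code no pair of terms. They are excluded from \<open>r\<close>, since
  \<^const>\<open>half_inverse\<close> needs a pair of terms for every element of \<open>r\<close>.
\<close>

definition subpresentation :: "nat \<Rightarrow> nat \<Rightarrow> nat \<Rightarrow> bool" where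
  "subpresentation k e r \<longleftrightarrow> (\<forall>c<r. c \<in> set_decode r \<longrightarrow> c \<in> W e \<and> (\<exists>a b. code_pair k a b c))"

text \<open>The negative condition gets the name because it is the semidecidable side: one
  enumerated relation that does not follow from \<open>r\<close> witnesses it.\<close>

definition incomplete :: "nat \<Rightarrow> nat \<Rightarrow> nat \<Rightarrow> bool" where
  "incomplete k e r \<longleftrightarrow> (\<exists>a b. term_code (vsig V) k a \<and> term_code (vsig V) k b \<and>
     pair_index (vsig V) k a b \<in> W e \<and> \<not> E k r a b)"

lemma semidec_subpresentation [semidec_intros]:
  assumes "computable k" "computable e" "computable r"
  shows "semidec (\<lambda>z. subpresentation (k z) (e z) (r z))"
  unfolding subpresentation_def
  by (intro semidec_intros; (rule semidec_dec)?; intro comp_intros assms computable_comp[OF assms(1)]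
      computable_comp[OF assms(2)] computable_comp[OF assms(3)])

lemma semidec_incomplete [semidec_intros]:
  assumes "computable k" "computable e" "computable r"
  shows "semidec (\<lambda>z. incomplete (k z) (e z) (r z))"
  unfolding incomplete_def
  by (intro semidec_intros; (rule semidec_dec)?; intro comp_intros assms computable_comp[OF assms(1)]
      computable_comp[OF assms(2)] computable_comp[OF assms(3)])

lemma subpresentation_iff:
  "subpresentation k e r \<longleftrightarrow> set_decode r \<subseteq> W e \<inter> pair_code (vsig V) k ` trm_pairs (vsig V) k"
  unfolding subpresentation_def code_pair_iff trm_pairs_def
  using in_set_decode_less by (auto simp: image_iff) blast+

text \<open>\<open>r\<close> lies inside \<open>W e\<close> and implies all of it, so the generated
  congruences coincide. The two algebras are then equal, and no isomorphism has to be
  composed.\<close>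

lemma presented_subpresentation:
  assumes "1 \<le> k" "subpresentation k e r" "\<not> incomplete k e r"
  shows "presented V k (rels k r) = Vfg V k e"
proof -
  let ?W = "decode_rels (vsig V) k (W e)"
  have "rels k r \<subseteq> ?W"
    using assms(2) unfolding subpresentation_iff by (auto simp: decode_rels_def)
  moreover have "?W \<subseteq> pres_cong V k (rels k r)"
  proof (rule subrelI)
    fix s t assume "(s, t) \<in> ?W"
    then have st: "s \<in> T k" "t \<in> T k" "pair_code (vsig V) k (s, t) \<in> W e"
      by (auto simp: decode_rels_def trm_pairs_def)
    then have "term_code (vsig V) k (trm_code s)" "term_code (vsig V) k (trm_code t)"
      "pair_index (vsig V) k (trm_code s) (trm_code t) \<in> W e"
      by (simp_all add: term_code_def pair_index_trm_code)
    then have "E k r (trm_code s) (trm_code t)" using assms(3) unfolding incomplete_def by blast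
    then show "(s, t) \<in> pres_cong V k (rels k r)" using E_iff assms(1) st(1,2) by blast
  qed
  ultimately have "pres_cong V k (rels k r) = pres_cong V k ?W"
    using pres_cong_mono pres_cong_least[OF law_congruence_pres_cong[OF decode_rels_subset]]
    by (meson subset_antisym)
  then show ?thesis by (simp add: Vfg_def presented_def)
qed

lemma complete_subpresentation_exists:
  assumes "1 \<le> k"
  obtains r where "subpresentation k e r" "\<not> incomplete k e r"
proof -
  obtain r where r: "set_decode r \<subseteq> W e \<inter> pair_code (vsig V) k ` trm_pairs (vsig V) k"
    "pres_cong V k (rels k r) = pres_cong V k (decode_rels (vsig V) k (W e))"
    using finite_subpresentation[OF acc assms] by blast
  have "\<not> incomplete k e r"
  proof
    assume "incomplete k e r"
    then obtain s t where st: "s \<in> T k" "t \<in> T k" "pair_code (vsig V) k (s, t) \<in> W e"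
      "\<not> E k r (trm_code s) (trm_code t)"
      unfolding incomplete_def by (auto simp: term_code_def pair_index_trm_code)
    then have "(s, t) \<in> decode_rels (vsig V) k (W e)" by (simp add: decode_rels_def trm_pairs_def)
    then have "(s, t) \<in> pres_cong V k (rels k r)"
      using pres_cong_superset[OF decode_rels_subset] r(2) by blast
    then show False using st E_iff assms by blast
  qed
  then show ?thesis using that r(1) unfolding subpresentation_iff by blast
qed

lemma Delta02_iso_Vfg: "Delta02 (iso_Vfg V)"
proof -
  \<comment> \<open>\<open>x\<close> codes the two indices and \<open>u\<close> the two finite
    subsets. If one of the numbers of generators is 0, then \<open>S\<close> holds vacuously while
    \<open>N\<close> and \<open>Q\<close> fail: every \<open>u\<close> is good and the answer is
    negative.\<close>
  define pos where "pos x \<longleftrightarrow> 1 \<le> pfst (pfst x) \<and> 1 \<le> pfst (psnd x)" for x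
  define S where "S x u \<longleftrightarrow> (pos x \<longrightarrow> subpresentation (pfst (pfst x)) (psnd (pfst x)) (pfst u) \<and>
    subpresentation (pfst (psnd x)) (psnd (psnd x)) (psnd u))" for x u
  define N where "N x u \<longleftrightarrow> pos x \<and> (incomplete (pfst (pfst x)) (psnd (pfst x)) (pfst u) \<or>
    incomplete (pfst (psnd x)) (psnd (psnd x)) (psnd u))" for x u
  define Q where "Q x u \<longleftrightarrow> pos x \<and>
    (\<exists>F G. half_inverse (pfst (pfst x)) (pfst u) (pfst (psnd x)) (psnd u) F G \<and>
      half_inverse (pfst (psnd x)) (psnd u) (pfst (pfst x)) (pfst u) G F)" for x u
  show ?thesis
  proof (rule Delta02I)
    show "semidec (\<lambda>w. S (pfst w) (psnd w))"
      unfolding S_def pos_def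
      by (intro semidec_intros; (rule semidec_dec)?; intro comp_intros)
    show "semidec (\<lambda>w. N (pfst w) (psnd w))"
      unfolding N_def pos_def
      by (intro semidec_intros; (rule semidec_dec)?; intro comp_intros)
    show "semidec (\<lambda>w. Q (pfst w) (psnd w))"
      unfolding Q_def pos_def
      by (intro semidec_intros; (rule semidec_dec)?; intro comp_intros)
    show "\<exists>u. S x u \<and> \<not> N x u" for x
    proof (cases "pos x")
      case True
      then obtain r s where "subpresentation (pfst (pfst x)) (psnd (pfst x)) r"
        "\<not> incomplete (pfst (pfst x)) (psnd (pfst x)) r"
        "subpresentation (pfst (psnd x)) (psnd (psnd x)) s"
        "\<not> incomplete (pfst (psnd x)) (psnd (psnd x)) s"
        unfolding pos_def by (metis complete_subpresentation_exists)
      then have "S x (prod_encode (r, s)) \<and> \<not> N x (prod_encode (r, s))"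
        by (simp add: S_def N_def)
      then show ?thesis by blast
    qed (simp add: S_def N_def)
    show "(a, b) \<in> iso_Vfg V \<longleftrightarrow> Q (prod_encode (a, b)) u"
      if u: "S (prod_encode (a, b)) u" "\<not> N (prod_encode (a, b)) u" for a b u
    proof -
      obtain k e j i where ab: "a = prod_encode (k, e)" "b = prod_encode (j, i)"
        by (metis prod_encode_pfst_psnd)
      have iso: "(a, b) \<in> iso_Vfg V \<longleftrightarrow> 1 \<le> k \<and> 1 \<le> j \<and> isomorphic (vsig V) (Vfg V k e) (Vfg V j i)"
        unfolding iso_Vfg_def ab by (auto simp: prod_encode_eq)
      show ?thesis
      proof (cases "1 \<le> k \<and> 1 \<le> j")
        case True
        then have sub: "subpresentation k e (pfst u)" "\<not> incomplete k e (pfst u)"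
          "subpresentation j i (psnd u)" "\<not> incomplete j i (psnd u)"
          using u by (auto simp: S_def N_def pos_def ab)
        have "presented V k (rels k (pfst u)) = Vfg V k e" "presented V j (rels j (psnd u)) = Vfg V j i"
          using presented_subpresentation sub True by blast+
        then show ?thesis
          using isomorphic_iff_half_inverse[of k j "pfst u" "psnd u"] True sub(1,3) iso
          unfolding subpresentation_iff Q_def pos_def ab by simp
      next
        case False
        then show ?thesis using iso by (auto simp: Q_def pos_def ab)
      qed
    qed
  qed
qed

end

section \<open>Deciding equality of terms from either decision problem\<close>

context well_formed_variety
begin

lemma isomorphism_problem_word_problem:
  assumes acc: "Vfg_acc V" and k: "1 \<le> k" and st: "s \<in> T k" "t \<in> T k"
    and r': "set_decode r' = insert (pair_code (vsig V) k (s, t)) (set_decode r)"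
  shows "isomorphic (vsig V) (fin_presented V k r) (fin_presented V k r') \<longleftrightarrow>
    (s, t) \<in> pres_cong V k (decode_rels (vsig V) k (set_decode r))"
proof -
  let ?R = "decode_rels (vsig V) k (set_decode r)"
  have pair: "pair_code (vsig V) k p = pair_code (vsig V) k (s, t) \<longleftrightarrow> p = (s, t)"
    if "p \<in> trm_pairs (vsig V) k" for p
    using inj_on_eq_iff[OF inj_on_pair_code that, of "(s, t)"] st by (simp add: trm_pairs_def)
  have "(s, t) \<in> trm_pairs (vsig V) k" using st by (simp add: trm_pairs_def)
  then have R': "decode_rels (vsig V) k (set_decode r') = insert (s, t) ?R"
    unfolding decode_rels_def r' by (auto simp: pair)
  have sub: "insert (s, t) ?R \<subseteq> trm_pairs (vsig V) k"
    using st decode_rels_subset by (auto simp: trm_pairs_def)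
  show ?thesis unfolding fin_presented_def R'
  proof
    assume "isomorphic (vsig V) (presented V k ?R) (presented V k (insert (s, t) ?R))"
    then have "pres_cong V k (insert (s, t) ?R) = pres_cong V k ?R"
      by (rule hopfian[OF acc k subset_insertI sub])
    then show "(s, t) \<in> pres_cong V k ?R" using pres_cong_superset[OF sub] by blast
  next
    assume "(s, t) \<in> pres_cong V k ?R"
    \<comment> \<open>A relation that already holds leaves the congruence unchanged, so the identity
      map is an isomorphism.\<close>
    then have "pres_cong V k (insert (s, t) ?R) = pres_cong V k ?R"
      using pres_cong_superset[OF decode_rels_subset, of k "set_decode r"]
        pres_cong_least[OF law_congruence_pres_cong[OF decode_rels_subset], of "insert (s, t) ?R" k "set_decode r"]
        pres_cong_mono[OF subset_insertI, of k ?R "(s, t)"] by blast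
    moreover have "isomorphic sig A A" for sig and A :: "trm set algebra"
      unfolding isomorphic_def by (rule exI[of _ id]) simp
    ultimately show "isomorphic (vsig V) (presented V k ?R) (presented V k (insert (s, t) ?R))"
      by (simp add: presented_def)
  qed
qed

lemma word_problem_imp_Delta02:
  assumes acc: "Vfg_acc V" and wp: "word_problem_decidable V"
  shows "Delta02 (iso_Vfg V)"
proof -
  obtain D where D: "decidable D" and D_def: "D =
     {prod_encode (k, prod_encode (r, pair_code (vsig V) k (s, t))) | k r s t.
        1 \<le> k \<and> (s, t) \<in> trm_pairs (vsig V) k \<and>
        (let \<theta> = pres_cong V k (decode_rels (vsig V) k (set_decode r)) in \<theta> `` {s} = \<theta> `` {t})}"
    using wp unfolding word_problem_decidable_def by blast
  interpret acc_word_problem V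
    "\<lambda>k r a b. prod_encode (k, prod_encode (r, pair_index (vsig V) k a b)) \<in> D"
  proof
    show "dec (\<lambda>w. prod_encode (pfst w, prod_encode (pfst (psnd w),
        pair_index (vsig V) (pfst w) (pfst (psnd (psnd w))) (psnd (psnd (psnd w))))) \<in> D)"
      by (rule dec_comp[OF D[unfolded decidable_iff_dec]]) (intro comp_intros)
    fix k r s t assume k: "1 \<le> k" and st: "s \<in> T k" "t \<in> T k"
    let ?\<theta> = "pres_cong V k (decode_rels (vsig V) k (set_decode r))"
    \<comment> \<open>Membership in \<open>D\<close> mentions the terms only through their pair
      code; injectivity recovers them.\<close>
    have pair: "(s', t') = (s, t)" if "(s', t') \<in> trm_pairs (vsig V) k"
      "pair_code (vsig V) k (s', t') = pair_code (vsig V) k (s, t)" for s' t'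
      using inj_onD[OF inj_on_pair_code that(2,1)] st by (simp add: trm_pairs_def)
    have "prod_encode (k, prod_encode (r, pair_code (vsig V) k (s, t))) \<in> D \<longleftrightarrow> ?\<theta> `` {s} = ?\<theta> `` {t}"
    proof
      assume "prod_encode (k, prod_encode (r, pair_code (vsig V) k (s, t))) \<in> D"
      then obtain s' t' where "(s', t') \<in> trm_pairs (vsig V) k"
        "pair_code (vsig V) k (s', t') = pair_code (vsig V) k (s, t)" "?\<theta> `` {s'} = ?\<theta> `` {t'}"
        unfolding D_def by (auto simp: prod_encode_eq Let_def)
      then show "?\<theta> `` {s} = ?\<theta> `` {t}" using pair by blast
    next
      assume "?\<theta> `` {s} = ?\<theta> `` {t}"
      then show "prod_encode (k, prod_encode (r, pair_code (vsig V) k (s, t))) \<in> D"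
        unfolding D_def using k st by (auto simp: prod_encode_eq Let_def trm_pairs_def)
    qed
    then show "prod_encode (k, prod_encode (r, pair_index (vsig V) k (trm_code s) (trm_code t))) \<in> D
        \<longleftrightarrow> (s, t) \<in> ?\<theta>"
      unfolding pair_index_trm_code
      using eq_equiv_class_iff[OF law_congruence_equiv[OF law_congruence_pres_cong[OF decode_rels_subset]] st]
      by blast
  qed (rule acc)
  show ?thesis by (rule Delta02_iso_Vfg)
qed

lemma isomorphism_problem_imp_Delta02:
  assumes acc: "Vfg_acc V" and ip: "isomorphism_problem_decidable V"
  shows "Delta02 (iso_Vfg V)"
proof -
  obtain D where D: "decidable D" and D_def: "D =
     {prod_encode (prod_encode (k, r), prod_encode (j, s)) | k r j s.
        1 \<le> k \<and> 1 \<le> j \<and> isomorphic (vsig V) (fin_presented V k r) (fin_presented V j s)}"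
    using ip unfolding isomorphism_problem_decidable_def by blast
  \<comment> \<open>Adding \<open>2 ^ c\<close> when digit \<open>c\<close> is already 1 would carry
    into higher digits, hence the case distinction.\<close>
  define add where "add r c = (if c \<in> set_decode r then r else 2 ^ c + r)" for r c
  have set_decode_add: "set_decode (add r c) = insert c (set_decode r)" for r c
    by (auto simp: add_def set_decode_plus_power_2)
  interpret acc_word_problem V "\<lambda>k r a b. prod_encode (prod_encode (k, r),
    prod_encode (k, add r (pair_index (vsig V) k a b))) \<in> D"
  proof
    show "dec (\<lambda>w. prod_encode (prod_encode (pfst w, pfst (psnd w)), prod_encode (pfst w,
        add (pfst (psnd w)) (pair_index (vsig V) (pfst w) (pfst (psnd (psnd w))) (psnd (psnd (psnd w)))))) \<in> D)"
      unfolding add_def by (rule dec_comp[OF D[unfolded decidable_iff_dec]]) (intro comp_intros)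
    fix k r s t assume k: "1 \<le> k" and st: "s \<in> T k" "t \<in> T k"
    show "prod_encode (prod_encode (k, r), prod_encode (k,
        add r (pair_index (vsig V) k (trm_code s) (trm_code t)))) \<in> D \<longleftrightarrow>
      (s, t) \<in> pres_cong V k (decode_rels (vsig V) k (set_decode r))"
      unfolding pair_index_trm_code
        isomorphism_problem_word_problem[OF acc k st set_decode_add, symmetric] D_def
      using k by (auto simp: prod_encode_eq)
  qed (rule acc)
  show ?thesis by (rule Delta02_iso_Vfg)
qed

end

theorem theorem4p21:
  fixes V :: variety
  assumes "is_variety V"
    and "Vfg_acc V"
  shows "(word_problem_decidable V \<longrightarrow> Delta02 (iso_Vfg V)) \<and>
         (isomorphism_problem_decidable V \<longrightarrow> Delta02 (iso_Vfg V))"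
proof -
  interpret well_formed_variety V
    using assms(1) by unfold_locales (simp add: is_variety_def)
  show ?thesis
    using word_problem_imp_Delta02 isomorphism_problem_imp_Delta02 assms(2) by blast
qed

end
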